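(* Let $Q$ be a finite quiver without loops with vertices $1,\dots,n$, let $\mathbf d=(d_1,\dots,d_n)$ be a dimension vector, let ${\boldsymbol\lambda}=(\lambda^1,\dots,\lambda^n)$ with $\lambda^i\vdash d_i$, and let $N=(N_i)$ be nilpotent linear operators on vector spaces $V_i$ of dimension $d_i$ with Jordan types $\lambda^i$. Consider the variety of representations of $Q$ with vector space $V_i$ at each vertex $i$ that are compatible with $N$ (i.e. $N_{t(a)}f_a=f_aN_{s(a)}$ for every arrow $a$). Then there are a dense open subset of this variety and a decomposition $\mathbf d=\mathbf d_1+\dots+\mathbf d_r$ such that every representation $M$ in this dense open set can be written as $M=M_1\oplus\dots\oplus M_r$ with each $M_j$ indecomposable and $\mathbf{dim}(M_j)=\mathbf d_j$ for all $j$.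
   Context: The ground field $\Bbbk$ is algebraically closed (standing assumption of the paper). *)

theory Defs
  imports "Jordan_Normal_Form.Jordan_Normal_Form" "HOL-Computational_Algebra.Polynomial"
begin

definition alg_closed :: "'a::field itself \<Rightarrow> bool" where
  "alg_closed _ \<longleftrightarrow> (\<forall>p::'a poly. degree p > 0 \<longrightarrow> (\<exists>x. poly p x = 0))"

text \<open>Quiver Q: vertices 0..n-1, finite arrow set E with source s and target t.
  A representation of dimension vector d: matrices f a of size d(t a) x d(s a).\<close>
definition is_rep :: "'e set \<Rightarrow> ('e \<Rightarrow> nat) \<Rightarrow> ('e \<Rightarrow> nat) \<Rightarrow> (nat \<Rightarrow> nat)
    \<Rightarrow> ('e \<Rightarrow> 'a::field mat) \<Rightarrow> bool" where
  "is_rep E s t d f \<longleftrightarrow> (\<forall>a\<in>E. f a \<in> carrier_mat (d (t a)) (d (s a)))"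

definition rep_iso :: "nat \<Rightarrow> 'e set \<Rightarrow> ('e \<Rightarrow> nat) \<Rightarrow> ('e \<Rightarrow> nat) \<Rightarrow> (nat \<Rightarrow> nat)
    \<Rightarrow> ('e \<Rightarrow> 'a::field mat) \<Rightarrow> ('e \<Rightarrow> 'a mat) \<Rightarrow> bool" where
  "rep_iso n E s t d f g \<longleftrightarrow> (\<exists>P. (\<forall>i<n. P i \<in> carrier_mat (d i) (d i) \<and> invertible_mat (P i))
      \<and> (\<forall>a\<in>E. P (t a) * f a = g a * P (s a)))"

definition rep_sum :: "('e \<Rightarrow> 'a::field mat) list \<Rightarrow> ('e \<Rightarrow> 'a mat)" where
  "rep_sum fs = (\<lambda>a. diag_block_mat (map (\<lambda>f. f a) fs))"

definition nonzero_dim :: "nat \<Rightarrow> (nat \<Rightarrow> nat) \<Rightarrow> bool" where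
  "nonzero_dim n d \<longleftrightarrow> (\<exists>i<n. d i \<noteq> 0)"

definition indecomposable :: "nat \<Rightarrow> 'e set \<Rightarrow> ('e \<Rightarrow> nat) \<Rightarrow> ('e \<Rightarrow> nat) \<Rightarrow> (nat \<Rightarrow> nat)
    \<Rightarrow> ('e \<Rightarrow> 'a::field mat) \<Rightarrow> bool" where
  "indecomposable n E s t d f \<longleftrightarrow> is_rep E s t d f \<and> nonzero_dim n d \<and>
     \<not> (\<exists>d1 d2 f1 f2. (\<forall>i<n. d i = d1 i + d2 i) \<and> nonzero_dim n d1 \<and> nonzero_dim n d2
        \<and> is_rep E s t d1 f1 \<and> is_rep E s t d2 f2 \<and> rep_iso n E s t d f (rep_sum [f1, f2]))"

text \<open>The variety of representations with V_i = k^(d_i) compatible with N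
  (points are canonicalised to the zero 0x0 matrix outside E).\<close>
definition compat_var :: "'e set \<Rightarrow> ('e \<Rightarrow> nat) \<Rightarrow> ('e \<Rightarrow> nat) \<Rightarrow> (nat \<Rightarrow> nat)
    \<Rightarrow> (nat \<Rightarrow> 'a::field mat) \<Rightarrow> ('e \<Rightarrow> 'a mat) set" where
  "compat_var E s t d N = {f. (\<forall>a\<in>E. f a \<in> carrier_mat (d (t a)) (d (s a))
      \<and> N (t a) * f a = f a * N (s a)) \<and> (\<forall>a. a \<notin> E \<longrightarrow> f a = 0\<^sub>m 0 0)}"

inductive_set poly_fun :: "'e set \<Rightarrow> ('e \<Rightarrow> nat) \<Rightarrow> ('e \<Rightarrow> nat) \<Rightarrow> (nat \<Rightarrow> nat)
    \<Rightarrow> (('e \<Rightarrow> 'a::field mat) \<Rightarrow> 'a) set" for E s t d where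
  pf_const: "(\<lambda>f. c) \<in> poly_fun E s t d"
| pf_coord: "a \<in> E \<Longrightarrow> i < d (t a) \<Longrightarrow> j < d (s a) \<Longrightarrow> (\<lambda>f. f a $$ (i, j)) \<in> poly_fun E s t d"
| pf_add: "p \<in> poly_fun E s t d \<Longrightarrow> q \<in> poly_fun E s t d \<Longrightarrow> (\<lambda>f. p f + q f) \<in> poly_fun E s t d"
| pf_mult: "p \<in> poly_fun E s t d \<Longrightarrow> q \<in> poly_fun E s t d \<Longrightarrow> (\<lambda>f. p f * q f) \<in> poly_fun E s t d"

definition zariski_closed_in :: "'e set \<Rightarrow> ('e \<Rightarrow> nat) \<Rightarrow> ('e \<Rightarrow> nat) \<Rightarrow> (nat \<Rightarrow> nat)
    \<Rightarrow> ('e \<Rightarrow> 'a::field mat) set \<Rightarrow> ('e \<Rightarrow> 'a mat) set \<Rightarrow> bool" where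
  "zariski_closed_in E s t d X C \<longleftrightarrow>
     (\<exists>S \<subseteq> poly_fun E s t d. C = {x \<in> X. \<forall>p\<in>S. p x = 0})"

definition zariski_open_in :: "'e set \<Rightarrow> ('e \<Rightarrow> nat) \<Rightarrow> ('e \<Rightarrow> nat) \<Rightarrow> (nat \<Rightarrow> nat)
    \<Rightarrow> ('e \<Rightarrow> 'a::field mat) set \<Rightarrow> ('e \<Rightarrow> 'a mat) set \<Rightarrow> bool" where
  "zariski_open_in E s t d X U \<longleftrightarrow> U \<subseteq> X \<and> zariski_closed_in E s t d X (X - U)"

definition zariski_dense_in :: "'e set \<Rightarrow> ('e \<Rightarrow> nat) \<Rightarrow> ('e \<Rightarrow> nat) \<Rightarrow> (nat \<Rightarrow> nat)
    \<Rightarrow> ('e \<Rightarrow> 'a::field mat) set \<Rightarrow> ('e \<Rightarrow> 'a mat) set \<Rightarrow> bool" where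
  "zariski_dense_in E s t d X U \<longleftrightarrow>
     (\<forall>V. zariski_open_in E s t d X V \<and> V \<noteq> {} \<longrightarrow> V \<inter> U \<noteq> {})"

end

(* There are only finitely many ways to write d as a sum of non-zero dimension vectors, and the set
   of representations that split into indecomposables of prescribed dimensions is first-order
   definable in the matrix entries. By Chevalley's theorem (quantifier elimination) these sets are
   constructible; finitely many of them cover the compatible variety, which is a linear space and
   hence irreducible, so one of them contains a non-empty principal open set. *)
theory Submission
  imports Defs
begin

subsection \<open>Quantifier elimination over algebraically closed fields\<close>

text \<open>Formulas get no syntax here: a predicate on an arbitrary parameter type is definable
  when it is the zero set of a single function, and an existential quantifier is a projection from a
  product type. Indecomposability negates an existential statement and then stands under a further
  existential quantifier over the summands, so the class must be closed under negation and
  projection alike. The obstacle to eliminating a variable \<open>y\<close> is that the degree in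
  \<open>y\<close> of a polynomial with parameter-dependent coefficients jumps with the parameter.
  Division with remainder and Euclid's algorithm are therefore carried out for whole families at
  once, the case distinctions on vanishing coefficients being absorbed into the functions. Algebraic
  closedness supplies the roots that elimination needs and makes the field infinite, on which the
  irreducibility of the linear space rests. The passage from a cover to an open set works because on
  an irreducible set a definable property is either generically true or generically false.\<close>

text \<open>Since \<open>inverse 0 = 0\<close>, the expression \<open>p x * inverse (p x)\<close> is the indicator of \<open>p x \<noteq> 0\<close>.
  Closing the generators under \<open>inverse\<close> therefore makes zero sets of single functions
  the same thing as constructible sets.\<close>
inductive_set meadow :: "('x \<Rightarrow> 'a::field) set \<Rightarrow> ('x \<Rightarrow> 'a) set" for G where
  meadow_gen: "g \<in> G \<Longrightarrow> g \<in> meadow G"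
| meadow_const: "(\<lambda>x. c) \<in> meadow G"
| meadow_add: "p \<in> meadow G \<Longrightarrow> q \<in> meadow G \<Longrightarrow> (\<lambda>x. p x + q x) \<in> meadow G"
| meadow_mult: "p \<in> meadow G \<Longrightarrow> q \<in> meadow G \<Longrightarrow> (\<lambda>x. p x * q x) \<in> meadow G"
| meadow_inverse: "p \<in> meadow G \<Longrightarrow> (\<lambda>x. inverse (p x)) \<in> meadow G"

definition definable :: "('x \<Rightarrow> 'a::field) set \<Rightarrow> ('x \<Rightarrow> bool) \<Rightarrow> bool" where
  "definable G P \<longleftrightarrow> (\<exists>p\<in>meadow G. \<forall>x. P x \<longleftrightarrow> p x = 0)"

lemma meadow_uminus: "p \<in> meadow G \<Longrightarrow> (\<lambda>x. - p x) \<in> meadow G"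
  using meadow_mult[OF meadow_const[of "-1"], of p G] by simp

lemma meadow_diff: "p \<in> meadow G \<Longrightarrow> q \<in> meadow G \<Longrightarrow> (\<lambda>x. p x - q x) \<in> meadow G"
  using meadow_add[OF _ meadow_uminus, of p G q] by simp

lemma meadow_sum: "(\<And>i. i \<in> A \<Longrightarrow> p i \<in> meadow G) \<Longrightarrow> (\<lambda>x. \<Sum>i\<in>A. p i x) \<in> meadow G"
  by (induction A rule: infinite_finite_induct) (auto intro: meadow_const meadow_add)

lemma definable_eq: "p \<in> meadow G \<Longrightarrow> q \<in> meadow G \<Longrightarrow> definable G (\<lambda>x. p x = q x)"
  unfolding definable_def by (intro bexI[of _ "\<lambda>x. p x - q x"]) (auto intro: meadow_diff)

lemma definable_neg: "definable G P \<Longrightarrow> definable G (\<lambda>x. \<not> P x)"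
  unfolding definable_def
proof (elim bexE)
  fix p assume p: "p \<in> meadow G" "\<forall>x. P x \<longleftrightarrow> p x = 0"
  have "(\<lambda>x. 1 - p x * inverse (p x)) \<in> meadow G"
    by (intro meadow_diff meadow_const meadow_mult meadow_inverse p)
  thus "\<exists>q\<in>meadow G. \<forall>x. \<not> P x \<longleftrightarrow> q x = 0"
  proof (rule bexI[rotated])
    show "\<forall>x. \<not> P x \<longleftrightarrow> 1 - p x * inverse (p x) = 0"
    proof
      fix x show "\<not> P x \<longleftrightarrow> 1 - p x * inverse (p x) = 0"
        using p(2)[rule_format, of x] by (cases "p x = 0") simp_all
    qed
  qed
qed

lemma definable_disj: "definable G P \<Longrightarrow> definable G Q \<Longrightarrow> definable G (\<lambda>x. P x \<or> Q x)"
  unfolding definable_def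
proof (elim bexE)
  fix p q assume "p \<in> meadow G" "\<forall>x. P x \<longleftrightarrow> p x = 0" "q \<in> meadow G" "\<forall>x. Q x \<longleftrightarrow> q x = 0"
  thus "\<exists>r\<in>meadow G. \<forall>x. P x \<or> Q x \<longleftrightarrow> r x = 0"
    by (intro bexI[of _ "\<lambda>x. p x * q x"]) (auto intro: meadow_mult)
qed

lemma definable_conj: "definable G P \<Longrightarrow> definable G Q \<Longrightarrow> definable G (\<lambda>x. P x \<and> Q x)"
  using definable_neg[OF definable_disj[OF definable_neg definable_neg], of G P Q] by simp

lemma definable_const: "definable G (\<lambda>x. c)"
  using definable_eq[OF meadow_const meadow_const, of G 0 "if c then 0 else 1"]
  by (cases c) auto

text \<open>A side condition \<open>c\<close> free of \<open>x\<close> may be assumed while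
  \<open>P\<close> is shown definable. Splitting into given dimension vectors needs this: its
  definability is proved under the assumption that they add up to \<open>d\<close>, so that matrix
  sizes match.\<close>

lemma definable_conj_const: "(c \<Longrightarrow> definable G P) \<Longrightarrow> definable G (\<lambda>x. c \<and> P x)"
  by (cases c) (auto intro: definable_const)

lemma definable_ball: "finite A \<Longrightarrow> (\<And>i. i \<in> A \<Longrightarrow> definable G (P i)) \<Longrightarrow> definable G (\<lambda>x. \<forall>i\<in>A. P i x)"
  by (induction A rule: finite_induct) (auto intro: definable_const definable_conj)

lemma definable_bex: "finite A \<Longrightarrow> (\<And>i. i \<in> A \<Longrightarrow> definable G (P i)) \<Longrightarrow> definable G (\<lambda>x. \<exists>i\<in>A. P i x)"
  by (induction A rule: finite_induct) (auto intro: definable_const definable_disj)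

lemma definable_cong: "definable G P \<Longrightarrow> (\<And>x. P x \<longleftrightarrow> Q x) \<Longrightarrow> definable G Q"
  by (simp add: definable_def)

lemma meadow_if:
  assumes "definable G P" "p \<in> meadow G" "q \<in> meadow G"
  shows "(\<lambda>x. if P x then p x else q x) \<in> meadow G"
proof -
  obtain c where c: "c \<in> meadow G" "\<forall>x. P x \<longleftrightarrow> c x = 0"
    using assms(1) unfolding definable_def by blast
  have "(\<lambda>x. c x * inverse (c x) * (q x - p x) + p x) \<in> meadow G"
    by (intro meadow_add meadow_mult meadow_inverse meadow_diff assms c)
  also have "(\<lambda>x. c x * inverse (c x) * (q x - p x) + p x) = (\<lambda>x. if P x then p x else q x)"
    using c(2) by auto
  finally show ?thesis .
qed

text \<open>All closure operations are pointwise, so after a change of variables only the generators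
  have to be checked.\<close>

lemma meadow_subst:
  assumes "p \<in> meadow G" "\<And>g. g \<in> G \<Longrightarrow> (\<lambda>y. g (\<sigma> y)) \<in> meadow H"
  shows "(\<lambda>y. p (\<sigma> y)) \<in> meadow H"
  using assms(1) by induction (auto intro: meadow.intros assms(2))

lemma definable_subst:
  assumes "definable G P" "\<And>g. g \<in> G \<Longrightarrow> (\<lambda>y. g (\<sigma> y)) \<in> meadow H"
  shows "definable H (\<lambda>y. P (\<sigma> y))"
  using assms(1) meadow_subst[OF _ assms(2)] unfolding definable_def by fastforce

text \<open>A defining function takes equal values at points that the generators do not separate. In
  this way variables that are not among the generators are seen to be irrelevant.\<close>

lemma definable_invariant:
  assumes "definable G P" "\<And>g. g \<in> G \<Longrightarrow> g x = g y"
  shows "P x \<longleftrightarrow> P y"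
proof -
  obtain p where p: "p \<in> meadow G" "\<forall>x. P x \<longleftrightarrow> p x = 0"
    using assms(1) unfolding definable_def by blast
  from p(1) have "p x = p y" by induction (auto simp: assms(2))
  with p(2) show ?thesis by simp
qed

section \<open>Polynomials in one variable with parameter-dependent coefficients\<close>

text \<open>These are polynomials in the variable to be eliminated. Coefficients may use
  \<open>inverse\<close>, so leading coefficients can be divided by. The actual degree may vary with
  \<open>x\<close>, but the common bound \<open>b\<close> keeps statements about all coefficients
  finite conjunctions.\<close>

definition poly_family :: "('x \<Rightarrow> 'a::field) set \<Rightarrow> ('x \<Rightarrow> 'a poly) set" where
  "poly_family G = {f. (\<forall>i. (\<lambda>x. coeff (f x) i) \<in> meadow G) \<and> (\<exists>b. \<forall>x. \<forall>i\<ge>b. coeff (f x) i = 0)}"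

lemma poly_family_coeff: "f \<in> poly_family G \<Longrightarrow> (\<lambda>x. coeff (f x) i) \<in> meadow G"
  by (simp add: poly_family_def)

lemma poly_family_bound: "f \<in> poly_family G \<Longrightarrow> \<exists>b. \<forall>x. \<forall>i\<ge>b. coeff (f x) i = 0"
  by (simp add: poly_family_def)

lemma poly_familyI:
  assumes "\<And>i. (\<lambda>x. coeff (f x) i) \<in> meadow G" "\<And>x i. i \<ge> b \<Longrightarrow> coeff (f x) i = 0"
  shows "f \<in> poly_family G"
  using assms unfolding poly_family_def by blast

lemma poly_family_monom: "p \<in> meadow G \<Longrightarrow> (\<lambda>x. monom (p x) k) \<in> poly_family G"
  by (rule poly_familyI[of _ _ "Suc k"]) (auto intro: meadow_const meadow_if definable_const)

lemma poly_family_const: "(\<lambda>x. p) \<in> poly_family G"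
  by (rule poly_familyI[of _ _ "Suc (degree p)"]) (auto intro: meadow_const coeff_eq_0)

lemma poly_family_add:
  assumes "f \<in> poly_family G" "g \<in> poly_family G"
  shows "(\<lambda>x. f x + g x) \<in> poly_family G"
proof -
  obtain b c where "\<forall>x. \<forall>i\<ge>b. coeff (f x) i = 0" "\<forall>x. \<forall>i\<ge>c. coeff (g x) i = 0"
    using assms poly_family_bound by blast
  moreover have "(\<lambda>x. coeff (f x + g x) i) \<in> meadow G" for i
    unfolding coeff_add by (intro meadow_add poly_family_coeff assms)
  ultimately show ?thesis by (intro poly_familyI[of _ _ "max b c"]) auto
qed

lemma poly_family_mult:
  assumes "f \<in> poly_family G" "g \<in> poly_family G"
  shows "(\<lambda>x. f x * g x) \<in> poly_family G"
proof -
  obtain b c where bc: "\<forall>x. \<forall>i\<ge>b. coeff (f x) i = 0" "\<forall>x. \<forall>i\<ge>c. coeff (g x) i = 0"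
    using assms poly_family_bound by blast
  have "coeff (f x * g x) i = 0" if "i \<ge> b + c" for x i
    unfolding coeff_mult
  proof (intro sum.neutral ballI)
    fix j assume "j \<in> {..i}"
    have "b \<le> j \<or> c \<le> i - j" using that by linarith
    with bc show "coeff (f x) j * coeff (g x) (i - j) = 0" by auto
  qed
  moreover have "(\<lambda>x. coeff (f x * g x) i) \<in> meadow G" for i
    unfolding coeff_mult by (intro meadow_sum meadow_mult poly_family_coeff assms)
  ultimately show ?thesis unfolding poly_family_def by blast
qed

lemma poly_family_diff:
  assumes "f \<in> poly_family G" "g \<in> poly_family G"
  shows "(\<lambda>x. f x - g x) \<in> poly_family G"
  using poly_family_add[OF assms(1) poly_family_mult[OF poly_family_const[of "-1"] assms(2)]] by simp

lemma poly_family_power: "f \<in> poly_family G \<Longrightarrow> (\<lambda>x. f x ^ m) \<in> poly_family G"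
  by (induction m) (auto intro: poly_family_const poly_family_mult)

lemma poly_family_if:
  assumes "definable G P" "f \<in> poly_family G" "g \<in> poly_family G"
  shows "(\<lambda>x. if P x then f x else g x) \<in> poly_family G"
proof -
  obtain b c where "\<forall>x. \<forall>i\<ge>b. coeff (f x) i = 0" "\<forall>x. \<forall>i\<ge>c. coeff (g x) i = 0"
    using assms poly_family_bound by blast
  hence "\<forall>x. \<forall>i\<ge>max b c. coeff (if P x then f x else g x) i = 0" by simp
  moreover have "(\<lambda>x. coeff (if P x then f x else g x) i) \<in> meadow G" for i
    unfolding if_distrib[of "\<lambda>p. coeff p i"] by (intro meadow_if assms poly_family_coeff)
  ultimately show ?thesis unfolding poly_family_def by blast
qed

lemma definable_poly_eq_0:
  assumes "f \<in> poly_family G"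
  shows "definable G (\<lambda>x. f x = 0)"
proof -
  obtain b where b: "\<forall>x. \<forall>i\<ge>b. coeff (f x) i = 0" using assms poly_family_bound by blast
  have "definable G (\<lambda>x. \<forall>i\<in>{..<b}. coeff (f x) i = 0)"
    by (intro definable_ball definable_eq poly_family_coeff assms meadow_const) auto
  thus ?thesis
  proof (rule definable_cong)
    show "(\<forall>i\<in>{..<b}. coeff (f x) i = 0) \<longleftrightarrow> f x = 0" for x
      using b unfolding poly_eq_iff by (metis coeff_0 lessThan_iff not_le)
  qed
qed

text \<open>Long division at those \<open>x\<close> where the divisor has exact degree
  \<open>k\<close>: each step removes the coefficient at \<open>b\<close> of the dividend, and the
  bound is the induction measure. Elsewhere \<open>r\<close> may be anything, so the bound on
  \<open>f\<close> is asked only at these \<open>x\<close>.\<close>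

lemma poly_family_mod_degree:
  assumes g: "g \<in> poly_family G" and f: "f \<in> poly_family G"
    and "\<forall>x. degree (g x) = k \<longrightarrow> g x \<noteq> 0 \<longrightarrow> (\<forall>i\<ge>b. coeff (f x) i = 0)"
  shows "\<exists>r\<in>poly_family G. \<forall>x. degree (g x) = k \<longrightarrow> g x \<noteq> 0 \<longrightarrow> r x = f x mod g x"
  using f assms(3)
proof (induction b arbitrary: f)
  case 0
  hence "\<forall>x. degree (g x) = k \<longrightarrow> g x \<noteq> 0 \<longrightarrow> f x = 0" by (auto simp: poly_eq_iff)
  thus ?case by (intro bexI[of _ "\<lambda>x. 0"] poly_family_const) auto
next
  case (Suc b)
  show ?case
  proof (cases "b < k")
    case True
    have "f x mod g x = f x" if "degree (g x) = k" "g x \<noteq> 0" for x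
    proof (rule mod_poly_less)
      have "degree (f x) \<le> b" using Suc.prems(2) that by (intro degree_le) auto
      thus "degree (f x) < degree (g x)" using True that by simp
    qed
    thus ?thesis using Suc.prems(1) by (intro bexI[of _ f]) auto
  next
    case False
    \<comment> \<open>The inverse is a genuine one where \<open>g x\<close> is nonzero of degree
      \<open>k\<close>. At other \<open>x\<close> its value is irrelevant, yet \<open>q\<close>
      remains a family.\<close>
    define q where "q x = monom (coeff (f x) b * inverse (coeff (g x) k)) (b - k)" for x
    define f' where "f' x = f x - q x * g x" for x
    have "q \<in> poly_family G" unfolding q_def[abs_def]
      by (intro poly_family_monom meadow_mult meadow_inverse poly_family_coeff g Suc.prems)
    hence f': "f' \<in> poly_family G" unfolding f'_def[abs_def]
      by (intro poly_family_diff poly_family_mult g Suc.prems)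
    have "coeff (f' x) i = 0" if "degree (g x) = k" "g x \<noteq> 0" "i \<ge> b" for x i
    proof (cases "i = b")
      case True
      have "coeff (g x) k \<noteq> 0" using that leading_coeff_0_iff by metis
      thus ?thesis using False True by (simp add: f'_def q_def coeff_monom_mult)
    next
      case neq: False
      have "coeff (g x) (i - (b - k)) = 0" using that neq False by (intro coeff_eq_0) auto
      thus ?thesis using that neq Suc.prems(2) by (simp add: f'_def q_def coeff_monom_mult)
    qed
    with Suc.IH[OF f'] obtain r where
      "r \<in> poly_family G" "\<forall>x. degree (g x) = k \<longrightarrow> g x \<noteq> 0 \<longrightarrow> r x = f' x mod g x" by blast
    moreover have "f' x mod g x = f x mod g x" for x
      unfolding f'_def by (simp add: mod_eq_dvd_iff)
    ultimately show ?thesis by auto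
  qed
qed

text \<open>The remainders for the individual degrees \<open>k\<close> are glued by definable case
  distinctions. Once the degree is known to be below \<open>Suc m\<close>, the single coefficient at
  \<open>m\<close> decides whether it equals \<open>m\<close>.\<close>

lemma poly_family_mod:
  assumes f: "f \<in> poly_family G" and g: "g \<in> poly_family G"
  shows "(\<lambda>x. f x mod g x) \<in> poly_family G"
proof -
  obtain b where b: "\<forall>x. \<forall>i\<ge>b. coeff (f x) i = 0" using f poly_family_bound by blast
  obtain c where c: "\<forall>x. \<forall>i\<ge>c. coeff (g x) i = 0" using g poly_family_bound by blast
  have "\<forall>k. \<exists>r\<in>poly_family G. \<forall>x. degree (g x) = k \<longrightarrow> g x \<noteq> 0 \<longrightarrow> r x = f x mod g x"
    using poly_family_mod_degree[OF g f] b by blast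
  then obtain r where r: "\<And>k. r k \<in> poly_family G"
    "\<And>k x. degree (g x) = k \<Longrightarrow> g x \<noteq> 0 \<Longrightarrow> r k x = f x mod g x" by metis
  have "\<exists>h\<in>poly_family G. \<forall>x. g x \<noteq> 0 \<longrightarrow> degree (g x) < m \<longrightarrow> h x = f x mod g x" for m
  proof (induction m)
    case 0
    show ?case using f by auto
  next
    case (Suc m)
    then obtain h where h: "h \<in> poly_family G"
      "\<forall>x. g x \<noteq> 0 \<longrightarrow> degree (g x) < m \<longrightarrow> h x = f x mod g x" by blast
    have "(\<lambda>x. if coeff (g x) m = 0 then h x else r m x) \<in> poly_family G"
      by (intro poly_family_if h r definable_eq meadow_const poly_family_coeff g)
    moreover have "(if coeff (g x) m = 0 then h x else r m x) = f x mod g x"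
      if "g x \<noteq> 0" "degree (g x) < Suc m" for x
    proof (cases "degree (g x) = m")
      case True
      hence "coeff (g x) m \<noteq> 0" using that leading_coeff_0_iff by metis
      thus ?thesis using r(2)[OF True that(1)] by simp
    next
      case False
      thus ?thesis using that h(2) by (simp add: coeff_eq_0)
    qed
    ultimately show ?case by (intro bexI) auto
  qed
  from this[of "Suc c"] obtain h where h: "h \<in> poly_family G"
    "\<forall>x. g x \<noteq> 0 \<longrightarrow> degree (g x) < Suc c \<longrightarrow> h x = f x mod g x" by blast
  have "degree (g x) < Suc c" for x using c by (simp add: degree_le less_Suc_eq_le)
  \<comment> \<open>Division by zero returns the dividend, whence the value \<open>f x\<close> in
    the branch \<open>g x = 0\<close>.\<close>
  hence "(\<lambda>x. if g x = 0 then f x else h x) = (\<lambda>x. f x mod g x)" using h(2) by auto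
  moreover have "(\<lambda>x. if g x = 0 then f x else h x) \<in> poly_family G"
    by (intro poly_family_if definable_poly_eq_0 f g h)
  ultimately show ?thesis by simp
qed

text \<open>Euclid's algorithm, uniform in \<open>x\<close>: the common roots of \<open>f\<close>
  and \<open>g\<close> are those of \<open>g\<close> and the remainder. The bound on the
  coefficients of the second polynomial drops in each round, so one number of rounds serves all
  \<open>x\<close>.\<close>

lemma poly_family_common_roots:
  assumes "f \<in> poly_family G" "g \<in> poly_family G"
  shows "\<exists>h\<in>poly_family G. \<forall>x y. poly (h x) y = 0 \<longleftrightarrow> poly (f x) y = 0 \<and> poly (g x) y = 0"
proof -
  obtain b where "\<forall>x. \<forall>i\<ge>b. coeff (g x) i = 0" using assms(2) poly_family_bound by blast
  with assms show ?thesis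
  proof (induction b arbitrary: f g)
    case 0
    hence "\<forall>x. g x = 0" by (auto simp: poly_eq_iff)
    thus ?case using 0 by (intro bexI[of _ f]) auto
  next
    case (Suc b)
    \<comment> \<open>The value 0 where \<open>g x = 0\<close> is essential: there
      \<open>f x mod g x\<close> would be \<open>f x\<close>, whose degree is not controlled by
      \<open>b\<close>.\<close>
    define r where "r x = (if g x = 0 then 0 else f x mod g x)" for x
    have r: "r \<in> poly_family G" unfolding r_def[abs_def]
      by (intro poly_family_if poly_family_mod definable_poly_eq_0 poly_family_const Suc.prems)
    have "coeff (r x) i = 0" if "i \<ge> b" for x i
    proof (cases "r x = 0")
      case False
      hence g: "g x \<noteq> 0" "r x = f x mod g x" by (auto simp: r_def split: if_splits)
      have "degree (r x) < degree (g x)" using degree_mod_less[OF g(1), of "f x"] False g by auto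
      moreover have "degree (g x) \<le> b" using Suc.prems(3) by (intro degree_le) auto
      ultimately show ?thesis using that by (intro coeff_eq_0) auto
    qed auto
    with Suc.IH[OF Suc.prems(2) r] obtain h where h: "h \<in> poly_family G"
      "\<forall>x y. poly (h x) y = 0 \<longleftrightarrow> poly (g x) y = 0 \<and> poly (r x) y = 0" by blast
    have "(\<lambda>x. if g x = 0 then f x else h x) \<in> poly_family G"
      by (intro poly_family_if definable_poly_eq_0 h Suc.prems)
    moreover have "poly (if g x = 0 then f x else h x) y = 0 \<longleftrightarrow> poly (f x) y = 0 \<and> poly (g x) y = 0" for x y
    proof (cases "g x = 0")
      case False
      have "poly (f x) y = poly (f x div g x) y * poly (g x) y + poly (f x mod g x) y"
        by (metis div_mult_mod_eq poly_add poly_mult)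
      thus ?thesis using False h(2) by (auto simp: r_def)
    qed auto
    ultimately show ?case
      by (intro bexI[of _ "\<lambda>x. if g x = 0 then f x else h x"] allI)
  qed
qed

section \<open>A one-variable Nullstellensatz\<close>

text \<open>For nonconstant \<open>g\<close>, a root of \<open>g + 1\<close> is a point where
  \<open>g\<close> takes the value -1.\<close>

lemma alg_closed_ex_nonroot:
  assumes "alg_closed TYPE('a::field)" "g \<noteq> (0 :: 'a poly)"
  shows "\<exists>y. poly g y \<noteq> 0"
proof (cases "degree g = 0")
  case True
  then obtain c where "g = [:c:]" by (metis degree_eq_zeroE)
  thus ?thesis using assms(2) by auto
next
  case False
  hence "degree (g + 1) > 0" by (simp add: degree_add_eq_left)
  then obtain y where "poly (g + 1) y = 0" using assms(1) unfolding alg_closed_def by blast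
  thus ?thesis by (intro exI[of _ y]) auto
qed

text \<open>Over a finite field the product of all \<open>[:-c, 1:]\<close> would be a nonzero
  polynomial vanishing everywhere.\<close>

lemma alg_closed_infinite:
  assumes "alg_closed TYPE('a::field)"
  shows "infinite (UNIV :: 'a set)"
proof
  assume fin: "finite (UNIV :: 'a set)"
  define p :: "'a poly" where "p = (\<Prod>c\<in>UNIV. [:-c, 1:])"
  have "p \<noteq> 0" unfolding p_def using fin by (simp add: prod_zero_iff)
  moreover have "poly p y = 0" for y
    unfolding p_def poly_prod using fin by (simp add: prod_zero_iff)
  ultimately show False using alg_closed_ex_nonroot[OF assms] by blast
qed

text \<open>The exponent is explicit: every linear factor split off from \<open>h\<close> belongs to
  a root, hence divides one of the \<open>m\<close> copies of \<open>g\<close>.\<close>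

lemma alg_closed_dvd_power:
  assumes "alg_closed TYPE('a::field)"
  shows "h \<noteq> (0 :: 'a poly) \<Longrightarrow> \<forall>y. poly h y = 0 \<longrightarrow> poly g y = 0 \<Longrightarrow> degree h \<le> m \<Longrightarrow> h dvd g ^ m"
proof (induction m arbitrary: h)
  case 0
  then obtain c where "h = [:c:]" "c \<noteq> 0" by (metis degree_eq_zeroE le_zero_eq pCons_0_0)
  thus ?case by (simp add: is_unit_pCons_iff is_unit_iff_degree)
next
  case (Suc m)
  show ?case
  proof (cases "degree h = 0")
    case True
    thus ?thesis using Suc.prems(1) by (simp add: is_unit_iff_degree unit_imp_dvd)
  next
    case False
    then obtain y where y: "poly h y = 0" using assms unfolding alg_closed_def by blast
    then obtain h' where h': "h = [:-y, 1:] * h'" using poly_eq_0_iff_dvd by (metis dvdE)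
    have "degree h = Suc (degree h')" using Suc.prems(1) unfolding h' by (subst degree_mult_eq) auto
    hence "h' dvd g ^ m" using Suc.prems h' by (intro Suc.IH) auto
    moreover have "[:-y, 1:] dvd g" using Suc.prems(2) y poly_eq_0_iff_dvd by blast
    ultimately show ?thesis unfolding h' power_Suc by (intro mult_dvd_mono)
  qed
qed

text \<open>This trades a quantifier for a remainder. The condition \<open>m > 0\<close> is for
  \<open>h = 0\<close>, where the remainder is \<open>g ^ m\<close> and has to vanish when
  \<open>g\<close> does.\<close>

lemma alg_closed_ex_root_nonroot_iff:
  assumes "alg_closed TYPE('a::field)" "degree (h :: 'a poly) \<le> m" "m > 0"
  shows "(\<exists>y. poly h y = 0 \<and> poly g y \<noteq> 0) \<longleftrightarrow> g ^ m mod h \<noteq> 0"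
proof (cases "h = 0")
  case True
  thus ?thesis using alg_closed_ex_nonroot[OF assms(1), of g] assms(3) by auto
next
  case False
  have "\<not> h dvd g ^ m" if y: "poly h y = 0" "poly g y \<noteq> 0" for y
  proof
    assume "h dvd g ^ m"
    then obtain k where "g ^ m = h * k" by (auto simp: dvd_def)
    hence "poly g y ^ m = poly h y * poly k y" by (metis poly_mult poly_power)
    thus False using y by simp
  qed
  thus ?thesis using alg_closed_dvd_power[OF assms(1) False _ assms(2)]
    by (auto simp: mod_eq_0_iff_dvd)
qed

section \<open>Elimination of one existential variable\<close>

text \<open>A triple \<open>(h, a, b)\<close> stands for the piece \<open>h = 0 \<noteq> b\<close>, on which the function is \<open>a / b\<close>.\<close>
lemma meadow_piecewise_fraction:
  fixes p :: "'x \<times> 'a::field \<Rightarrow> 'a"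
  assumes "p \<in> meadow (insert snd ((\<lambda>g z. g (fst z)) ` G))"
  shows "\<exists>L. finite L \<and> L \<subseteq> poly_family G \<times> poly_family G \<times> poly_family G
    \<and> (\<forall>x y. \<exists>(h,a,b)\<in>L. poly (h x) y = 0 \<and> poly (b x) y \<noteq> 0)
    \<and> (\<forall>x y. \<forall>(h,a,b)\<in>L. poly (h x) y = 0 \<longrightarrow> poly (b x) y \<noteq> 0 \<longrightarrow> p (x, y) = poly (a x) y / poly (b x) y)"
    (is "\<exists>L. ?good p L")
proof -
  have base: "\<exists>L. ?good p L" if "a \<in> poly_family G" "\<And>x y. p (x, y) = poly (a x) y" for p a
    using that by (intro exI[of _ "{(\<lambda>x. 0, a, \<lambda>x. 1)}"]) (auto intro: poly_family_const)
  \<comment> \<open>Despite the name only the zero set matters: \<open>gcd\<close> expresses two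
    equations by one.\<close>
  obtain gcd where gcd: "\<And>f g. f \<in> poly_family G \<Longrightarrow> g \<in> poly_family G \<Longrightarrow> gcd f g \<in> poly_family G"
    "\<And>f g x y. f \<in> poly_family G \<Longrightarrow> g \<in> poly_family G \<Longrightarrow>
      poly (gcd f g x) y = 0 \<longleftrightarrow> poly (f x) y = 0 \<and> poly (g x) y = 0"
    using poly_family_common_roots[of _ G] by metis
  \<comment> \<open>Sum and product are treated together, with \<open>\<nu>\<close> building the
    numerator over the common denominator \<open>b * d\<close>. Pieces are intersected pairwise.
    They cover but may overlap, which is harmless since each computes the same value.\<close>
  have binop: "\<exists>L. ?good r L" if p: "\<exists>L. ?good p L" and q: "\<exists>L. ?good q L"
    and num: "\<And>a b c d. a \<in> poly_family G \<Longrightarrow> b \<in> poly_family G \<Longrightarrow> c \<in> poly_family G \<Longrightarrow> d \<in> poly_family G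
      \<Longrightarrow> \<nu> a b c d \<in> poly_family G"
    and eq: "\<And>a b c d x y. poly (b x) y \<noteq> 0 \<Longrightarrow> poly (d x) y \<noteq> 0 \<Longrightarrow>
      p (x, y) = poly (a x) y / poly (b x) y \<Longrightarrow> q (x, y) = poly (c x) y / poly (d x) y \<Longrightarrow>
      r (x, y) = poly (\<nu> a b c d x) y / (poly (b x) y * poly (d x) y)"
    for p q r \<nu>
  proof -
    obtain L M where L: "?good p L" and M: "?good q M" using p q by blast
    define K where "K = (\<lambda>((h,a,b),(k,c,d)). (gcd h k, \<nu> a b c d, \<lambda>x. b x * d x)) ` (L \<times> M)"
    have "finite K" unfolding K_def using L M by blast
    moreover have "K \<subseteq> poly_family G \<times> poly_family G \<times> poly_family G"
      unfolding K_def using L M by (fastforce intro!: gcd num poly_family_mult)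
    moreover have "\<exists>(h,a,b)\<in>K. poly (h x) y = 0 \<and> poly (b x) y \<noteq> 0" for x y
    proof -
      obtain h a b where 1: "(h,a,b) \<in> L" "poly (h x) y = 0" "poly (b x) y \<noteq> 0" using L by blast
      obtain k c d where 2: "(k,c,d) \<in> M" "poly (k x) y = 0" "poly (d x) y \<noteq> 0" using M by blast
      have "(gcd h k, \<nu> a b c d, \<lambda>x. b x * d x) \<in> K" unfolding K_def using 1 2 by force
      moreover have "h \<in> poly_family G" "k \<in> poly_family G" using 1 2 L M by auto
      ultimately show ?thesis using 1 2
        by (intro bexI[of _ "(gcd h k, \<nu> a b c d, \<lambda>x. b x * d x)"]) (auto simp: gcd(2))
    qed
    moreover have "r (x, y) = poly (u x) y / poly (v x) y"
      if uv: "(e,u,v) \<in> K" "poly (e x) y = 0" "poly (v x) y \<noteq> 0" for x y e u v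
    proof -
      obtain h a b k c d where *: "(h,a,b) \<in> L" "(k,c,d) \<in> M" "e = gcd h k" "u = \<nu> a b c d"
        "v = (\<lambda>x. b x * d x)" using uv(1) unfolding K_def by auto
      moreover have "h \<in> poly_family G" "k \<in> poly_family G" using * L M by auto
      ultimately have "poly (h x) y = 0" "poly (k x) y = 0" "poly (b x) y \<noteq> 0" "poly (d x) y \<noteq> 0"
        using uv by (auto simp: gcd(2))
      hence "p (x, y) = poly (a x) y / poly (b x) y" "q (x, y) = poly (c x) y / poly (d x) y"
        using * L M by fast+
      thus ?thesis using eq[of b x y d] \<open>poly (b x) y \<noteq> 0\<close> \<open>poly (d x) y \<noteq> 0\<close> * by simp
    qed
    ultimately have "?good r K" by (intro conjI allI) auto
    thus ?thesis by (rule exI)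
  qed
  from assms show ?thesis
  proof induction
    case (meadow_gen g)
    then consider "g = snd" | g' where "g' \<in> G" "g = (\<lambda>z. g' (fst z))" by auto
    thus ?case
    proof cases
      case 1
      show ?thesis by (rule base[of "\<lambda>x. [:0, 1:]"]) (auto intro: poly_family_const simp: 1)
    next
      case 2
      have "(\<lambda>x. monom (g' x) 0) \<in> poly_family G"
        using 2 by (intro poly_family_monom meadow.meadow_gen)
      thus ?thesis by (rule base) (simp add: 2 poly_monom)
    qed
  next
    case (meadow_const c)
    show ?case by (rule base[of "\<lambda>x. [:c:]"]) (auto intro: poly_family_const)
  next
    case (meadow_add p q)
    show ?case
      by (rule binop[OF meadow_add.IH, of "\<lambda>a b c d x. a x * d x + c x * b x"])
        (auto intro!: poly_family_add poly_family_mult simp: add_frac_eq)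
  next
    case (meadow_mult p q)
    show ?case
      by (rule binop[OF meadow_mult.IH, of "\<lambda>a b c d x. a x * c x"])
        (auto intro!: poly_family_mult)
  next
    case (meadow_inverse p)
    then obtain L where L: "?good p L" by blast
    \<comment> \<open>Each piece is split by \<open>a \<noteq> 0\<close> and \<open>a = 0\<close>.
      In the first case b / a carries an extra factor \<open>b\<close> above and below, so that a
      nonzero denominator still forces \<open>b \<noteq> 0\<close>. In the second,
      \<open>inverse 0 = 0\<close> gives the fraction 0 / b.\<close>
    define K where "K = (\<lambda>(h,a,b). (h, \<lambda>x. b x * b x, \<lambda>x. a x * b x)) ` L
      \<union> (\<lambda>(h,a,b). (gcd h a, \<lambda>x. 0, b)) ` L"
    have "finite K" unfolding K_def using L by blast
    moreover have "K \<subseteq> poly_family G \<times> poly_family G \<times> poly_family G"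
      unfolding K_def using L by (fastforce intro!: gcd poly_family_mult poly_family_const)
    moreover have "\<exists>(h,a,b)\<in>K. poly (h x) y = 0 \<and> poly (b x) y \<noteq> 0" for x y
    proof -
      obtain h a b where 1: "(h,a,b) \<in> L" "poly (h x) y = 0" "poly (b x) y \<noteq> 0" using L by blast
      have "(h, \<lambda>x. b x * b x, \<lambda>x. a x * b x) \<in> K" "(gcd h a, \<lambda>x. 0, b) \<in> K"
        unfolding K_def using 1 by force+
      moreover have ha: "h \<in> poly_family G" "a \<in> poly_family G" using 1 L by auto
      ultimately show ?thesis using 1
        by (cases "poly (a x) y = 0")
          (rule bexI[of _ "(gcd h a, \<lambda>x. 0, b)"], auto simp: gcd(2)[OF ha],
           rule bexI[of _ "(h, \<lambda>x. b x * b x, \<lambda>x. a x * b x)"], auto)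
    qed
    moreover have "inverse (p (x, y)) = poly (u x) y / poly (v x) y"
      if uv: "(e,u,v) \<in> K" "poly (e x) y = 0" "poly (v x) y \<noteq> 0" for x y e u v
    proof -
      from uv(1) obtain h a b where *: "(h,a,b) \<in> L" and
        alt: "e = h \<and> u = (\<lambda>x. b x * b x) \<and> v = (\<lambda>x. a x * b x) \<or> e = gcd h a \<and> u = (\<lambda>x. 0) \<and> v = b"
        unfolding K_def by auto
      have "h \<in> poly_family G" "a \<in> poly_family G" using * L by auto
      with alt uv have "poly (h x) y = 0" "poly (b x) y \<noteq> 0" by (auto simp: gcd(2))
      hence "p (x, y) = poly (a x) y / poly (b x) y" using * L by fast
      thus ?thesis using alt uv \<open>h \<in> poly_family G\<close> \<open>a \<in> poly_family G\<close> by (auto simp: gcd(2))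
    qed
    ultimately have "?good (\<lambda>z. inverse (p z)) K"
      by (intro conjI allI) auto
    thus ?case by (rule exI)
  qed
qed

text \<open>On a piece, \<open>p\<close> vanishes exactly where the numerator does, so the
  quantifier asks for a common root of \<open>h\<close> and \<open>a\<close> that is no root of
  \<open>b\<close>. With \<open>h\<close> and \<open>a\<close> merged into one polynomial, the
  remainder criterion removes \<open>y\<close>.\<close>

lemma definable_ex:
  fixes P :: "'x \<times> 'a::field \<Rightarrow> bool"
  assumes "alg_closed TYPE('a)" "definable (insert snd ((\<lambda>g z. g (fst z)) ` G)) P"
  shows "definable G (\<lambda>x. \<exists>y. P (x, y))"
proof -
  obtain p where p: "p \<in> meadow (insert snd ((\<lambda>g z. g (fst z)) ` G))" "\<forall>z. P z \<longleftrightarrow> p z = 0"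
    using assms(2) unfolding definable_def by blast
  from meadow_piecewise_fraction[OF p(1)] obtain L where
    L: "finite L" "L \<subseteq> poly_family G \<times> poly_family G \<times> poly_family G"
      "\<And>x y. \<exists>(h,a,b)\<in>L. poly (h x) y = 0 \<and> poly (b x) y \<noteq> 0"
      "\<And>x y h a b. (h,a,b)\<in>L \<Longrightarrow> poly (h x) y = 0 \<Longrightarrow> poly (b x) y \<noteq> 0 \<Longrightarrow>
         p (x, y) = poly (a x) y / poly (b x) y" by fast
  have "(\<exists>y. P (x, y)) \<longleftrightarrow>
    (\<exists>l\<in>L. \<exists>y. (poly (fst l x) y = 0 \<and> poly (fst (snd l) x) y = 0) \<and> poly (snd (snd l) x) y \<noteq> 0)" for x
  proof
    assume "\<exists>y. P (x, y)"
    then obtain y where y: "p (x, y) = 0" using p(2) by blast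
    obtain h a b where 1: "(h,a,b) \<in> L" "poly (h x) y = 0" "poly (b x) y \<noteq> 0" using L(3) by blast
    thus "\<exists>l\<in>L. \<exists>y. (poly (fst l x) y = 0 \<and> poly (fst (snd l) x) y = 0) \<and> poly (snd (snd l) x) y \<noteq> 0"
      using L(4)[OF 1] y by (intro bexI[OF _ 1(1)]) auto
  next
    assume "\<exists>l\<in>L. \<exists>y. (poly (fst l x) y = 0 \<and> poly (fst (snd l) x) y = 0) \<and> poly (snd (snd l) x) y \<noteq> 0"
    then obtain h a b y where 1: "(h,a,b) \<in> L" "poly (h x) y = 0" "poly (b x) y \<noteq> 0" "poly (a x) y = 0"
      by auto
    thus "\<exists>y. P (x, y)" using L(4)[OF 1(1-3)] p(2) by auto
  qed
  moreover have "definable G (\<lambda>x. \<exists>l\<in>L. \<exists>y. (poly (fst l x) y = 0 \<and> poly (fst (snd l) x) y = 0)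
    \<and> poly (snd (snd l) x) y \<noteq> 0)"
  proof (rule definable_bex[OF L(1)])
    fix l assume "l \<in> L"
    then obtain h a b where l: "l = (h,a,b)" "h \<in> poly_family G" "a \<in> poly_family G" "b \<in> poly_family G"
      using L(2) by auto
    obtain k where k: "k \<in> poly_family G" "\<forall>x y. poly (k x) y = 0 \<longleftrightarrow> poly (h x) y = 0 \<and> poly (a x) y = 0"
      using poly_family_common_roots[OF l(2,3)] by blast
    obtain m where m: "\<forall>x. \<forall>i\<ge>m. coeff (k x) i = 0" using k(1) poly_family_bound by blast
    \<comment> \<open>\<open>m\<close> already bounds the degree. The successor makes the exponent
      positive, as the criterion requires.\<close>
    have deg: "degree (k x) \<le> Suc m" for x using m by (intro degree_le) auto
    have "(\<exists>y. (poly (h x) y = 0 \<and> poly (a x) y = 0) \<and> poly (b x) y \<noteq> 0) \<longleftrightarrow>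
      \<not> b x ^ Suc m mod k x = 0" for x
      using alg_closed_ex_root_nonroot_iff[OF assms(1) deg, of x "b x"] k(2) by simp
    moreover have "definable G (\<lambda>x. \<not> b x ^ Suc m mod k x = 0)"
      by (intro definable_neg definable_poly_eq_0 poly_family_mod poly_family_power k l)
    ultimately show "definable G (\<lambda>x. \<exists>y. (poly (fst l x) y = 0 \<and> poly (fst (snd l) x) y = 0)
      \<and> poly (snd (snd l) x) y \<noteq> 0)"
      unfolding l fst_conv snd_conv by simp
  qed
  ultimately show ?thesis by simp
qed

section \<open>Elimination of finitely many variables\<close>

text \<open>A family of matrices is quantified over as one function whose arguments index all
  entries. Definable predicates see only its values on \<open>I\<close>, which makes a quantifier
  over functions a finite one.\<close>

definition adjoin_coords :: "'i set \<Rightarrow> ('x \<Rightarrow> 'a) set \<Rightarrow> ('x \<times> ('i \<Rightarrow> 'a) \<Rightarrow> 'a) set" where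
  "adjoin_coords I G = (\<lambda>i z. snd z i) ` I \<union> (\<lambda>g z. g (fst z)) ` G"

lemma meadow_adjoin_coord: "i \<in> I \<Longrightarrow> (\<lambda>z. snd z i) \<in> meadow (adjoin_coords I G)"
  by (rule meadow_gen) (auto simp: adjoin_coords_def)

lemma meadow_adjoin_base: "p \<in> meadow G \<Longrightarrow> (\<lambda>z. p (fst z)) \<in> meadow (adjoin_coords I G)"
  by (rule meadow_subst) (auto simp: adjoin_coords_def intro: meadow_gen)

lemma definable_ex_coords:
  fixes P :: "'x \<times> ('i \<Rightarrow> 'a::field) \<Rightarrow> bool"
  assumes ac: "alg_closed TYPE('a)" and I: "finite I" and P: "definable (adjoin_coords I G) P"
  shows "definable G (\<lambda>x. \<exists>h. P (x, h))"
proof -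
  \<comment> \<open>The induction needs the coordinates outside \<open>I\<close> held fixed, at the
    values of \<open>snd z\<close>, so that each step releases exactly one coordinate.\<close>
  have "definable (adjoin_coords {} G) (\<lambda>z. \<exists>h. (\<forall>i. i \<notin> I \<longrightarrow> h i = snd z i) \<and> P (fst z, h))"
    using I P
  proof (induction I arbitrary: P rule: finite_induct)
    case empty
    hence "(\<exists>h. (\<forall>i. i \<notin> {} \<longrightarrow> h i = snd z i) \<and> P (fst z, h)) \<longleftrightarrow> P z" for z
      by (cases z) (auto simp: fun_eq_iff[symmetric])
    with empty show ?case by simp
  next
    case (insert i I)
    \<comment> \<open>Coordinate \<open>i\<close> is moved out of the function into a fresh last
      variable, the shape that one-variable elimination expects.\<close>
    have "definable (insert snd ((\<lambda>g z. g (fst z)) ` adjoin_coords I G))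
      (\<lambda>z. P (fst (fst z), (snd (fst z))(i := snd z)))"
    proof (rule definable_subst[OF insert.prems])
      fix g assume "g \<in> adjoin_coords (insert i I) G"
      then consider "g = (\<lambda>z. snd z i)" | j where "j \<in> I" "j \<noteq> i" "g = (\<lambda>z. snd z j)"
        | g' where "g' \<in> G" "g = (\<lambda>z. g' (fst z))"
        using insert.hyps by (auto simp: adjoin_coords_def)
      thus "(\<lambda>z. g (fst (fst z), (snd (fst z))(i := snd z)))
        \<in> meadow (insert snd ((\<lambda>g z. g (fst z)) ` adjoin_coords I G))"
        by cases (auto intro!: meadow_gen simp: adjoin_coords_def image_iff)
    qed
    from definable_ex[OF ac this]
    have "definable (adjoin_coords I G) (\<lambda>z. \<exists>y. P (fst z, (snd z)(i := y)))" by simp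
    from insert.IH[OF this]
    show ?case
    proof (rule definable_cong)
      fix z :: "'x \<times> ('i \<Rightarrow> 'a)"
      show "(\<exists>h. (\<forall>j. j \<notin> I \<longrightarrow> h j = snd z j) \<and> (\<exists>y. P (fst (fst z, h), (snd (fst z, h))(i := y))))
        \<longleftrightarrow> (\<exists>h. (\<forall>j. j \<notin> insert i I \<longrightarrow> h j = snd z j) \<and> P (fst z, h))" (is "?l \<longleftrightarrow> ?r")
      proof
        assume ?l
        then obtain h y where "\<forall>j. j \<notin> I \<longrightarrow> h j = snd z j" "P (fst z, h(i := y))" by auto
        thus ?r by (intro exI[of _ "h(i := y)"]) auto
      next
        assume ?r
        then obtain h where "\<forall>j. j \<notin> insert i I \<longrightarrow> h j = snd z j" "P (fst z, h)" by auto
        thus ?l by (intro exI[of _ "h(i := snd z i)"] conjI exI[of _ "h i"]) auto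
      qed
    qed
  qed
  then have "definable G (\<lambda>x. \<exists>h. (\<forall>i. i \<notin> I \<longrightarrow> h i = 0) \<and> P (x, h))"
  proof -
    assume Q: "definable (adjoin_coords {} G) (\<lambda>z. \<exists>h. (\<forall>i. i \<notin> I \<longrightarrow> h i = snd z i) \<and> P (fst z, h))"
      (is "definable _ ?Q")
    \<comment> \<open>Over \<open>{}\<close> no coordinate is a generator any more, so the fixed
      values may be chosen. They are set to 0.\<close>
    have "definable G (\<lambda>x. ?Q (x, \<lambda>_. 0))"
      by (rule definable_subst[OF Q]) (auto simp: adjoin_coords_def intro: meadow_gen)
    thus ?thesis by simp
  qed
  thus ?thesis
  proof (rule definable_cong)
    fix x
    \<comment> \<open>Truncating \<open>h\<close> to \<open>I\<close> changes the value of no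
      generator.\<close>
    have *: "P (x, h) \<longleftrightarrow> P (x, \<lambda>i. if i \<in> I then h i else 0)" for h
      by (rule definable_invariant[OF P]) (auto simp: adjoin_coords_def)
    show "(\<exists>h. (\<forall>i. i \<notin> I \<longrightarrow> h i = 0) \<and> P (x, h)) \<longleftrightarrow> (\<exists>h. P (x, h))"
    proof
      assume "\<exists>h. P (x, h)"
      then obtain h where "P (x, h)" by blast
      thus "\<exists>h. (\<forall>i. i \<notin> I \<longrightarrow> h i = 0) \<and> P (x, h)"
        using * by (intro exI[of _ "\<lambda>i. if i \<in> I then h i else 0"]) auto
    qed blast
  qed
qed

subsection \<open>Definability of decomposition types\<close>

text \<open>The shape must not depend on \<open>x\<close>: an equation between such matrices is then
  a fixed finite set of equations between entries.\<close>

definition definable_mat :: "('x \<Rightarrow> 'a::field) set \<Rightarrow> nat \<Rightarrow> nat \<Rightarrow> ('x \<Rightarrow> 'a mat) \<Rightarrow> bool" where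
  "definable_mat G r c A \<longleftrightarrow> (\<forall>x. A x \<in> carrier_mat r c) \<and> (\<forall>i<r. \<forall>j<c. (\<lambda>x. A x $$ (i, j)) \<in> meadow G)"

lemma definable_matI:
  "(\<And>x. A x \<in> carrier_mat r c) \<Longrightarrow> (\<And>i j. i < r \<Longrightarrow> j < c \<Longrightarrow> (\<lambda>x. A x $$ (i, j)) \<in> meadow G)
    \<Longrightarrow> definable_mat G r c A"
  by (simp add: definable_mat_def)

lemma definable_mat_carrier: "definable_mat G r c A \<Longrightarrow> A x \<in> carrier_mat r c"
  by (simp add: definable_mat_def)

lemma definable_mat_index: "definable_mat G r c A \<Longrightarrow> i < r \<Longrightarrow> j < c \<Longrightarrow> (\<lambda>x. A x $$ (i, j)) \<in> meadow G"
  by (simp add: definable_mat_def)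

lemma definable_mat_const: "A \<in> carrier_mat r c \<Longrightarrow> definable_mat G r c (\<lambda>x. A)"
  by (intro definable_matI meadow_const)

lemma definable_mat_mat:
  "(\<And>i j. i < r \<Longrightarrow> j < c \<Longrightarrow> (\<lambda>x. f x (i, j)) \<in> meadow G) \<Longrightarrow> definable_mat G r c (\<lambda>x. mat r c (f x))"
  by (intro definable_matI) simp_all

lemma definable_mat_mult:
  assumes A: "definable_mat G r m A" and B: "definable_mat G m c B"
  shows "definable_mat G r c (\<lambda>x. A x * B x)"
proof (rule definable_matI)
  note [simp] = carrier_matD[OF definable_mat_carrier[OF A]] carrier_matD[OF definable_mat_carrier[OF B]]
  show "A x * B x \<in> carrier_mat r c" for x
    using assms definable_mat_carrier by (metis mult_carrier_mat)
  fix i j assume ij: "i < r" "j < c"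
  have "(\<lambda>x. (A x * B x) $$ (i, j)) = (\<lambda>x. \<Sum>k\<in>{0..<m}. A x $$ (i, k) * B x $$ (k, j))"
    using ij by (auto simp: scalar_prod_def)
  also have "\<dots> \<in> meadow G"
    by (intro meadow_sum meadow_mult definable_mat_index[OF A] definable_mat_index[OF B] ij) auto
  finally show "(\<lambda>x. (A x * B x) $$ (i, j)) \<in> meadow G" .
qed

lemma definable_mat_eq:
  assumes A: "definable_mat G r c A" and B: "definable_mat G r c B"
  shows "definable G (\<lambda>x. A x = B x)"
proof -
  have "definable G (\<lambda>x. \<forall>i\<in>{..<r}. \<forall>j\<in>{..<c}. A x $$ (i, j) = B x $$ (i, j))"
    by (intro definable_ball definable_eq definable_mat_index[OF A] definable_mat_index[OF B]) auto
  thus ?thesis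
  proof (rule definable_cong)
    note [simp] = carrier_matD[OF definable_mat_carrier[OF A]] carrier_matD[OF definable_mat_carrier[OF B]]
    show "(\<forall>i\<in>{..<r}. \<forall>j\<in>{..<c}. A x $$ (i, j) = B x $$ (i, j)) \<longleftrightarrow> A x = B x" for x
      by (auto intro: eq_matI)
  qed
qed

lemma definable_mat_diag:
  assumes "\<And>j. j \<in> set js \<Longrightarrow> definable_mat G (r j) (c j) (A j)"
  shows "definable_mat G (\<Sum>j\<leftarrow>js. r j) (\<Sum>j\<leftarrow>js. c j) (\<lambda>x. diag_block_mat (map (\<lambda>j. A j x) js))"
  using assms
proof (induction js)
  case Nil
  show ?case by (auto intro: definable_mat_const)
next
  case (Cons k js)
  define B where "B x = diag_block_mat (map (\<lambda>j. A j x) js)" for x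
  define r' c' where "r' = (\<Sum>j\<leftarrow>js. r j)" and "c' = (\<Sum>j\<leftarrow>js. c j)"
  have A: "definable_mat G (r k) (c k) (A k)" using Cons.prems by simp
  have B: "definable_mat G r' c' B" unfolding B_def[abs_def] r'_def c'_def
    by (rule Cons.IH) (use Cons.prems in auto)
  note [simp] = carrier_matD[OF definable_mat_carrier[OF A]] carrier_matD[OF definable_mat_carrier[OF B]]
  have "definable_mat G (r k + r') (c k + c') (\<lambda>x. four_block_mat (A k x) (0\<^sub>m (r k) c') (0\<^sub>m r' (c k)) (B x))"
  proof (rule definable_matI)
    show "four_block_mat (A k x) (0\<^sub>m (r k) c') (0\<^sub>m r' (c k)) (B x) \<in> carrier_mat (r k + r') (c k + c')" for x
      by (intro four_block_carrier_mat definable_mat_carrier[OF A] definable_mat_carrier[OF B])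
    fix i j assume ij: "i < r k + r'" "j < c k + c'"
    \<comment> \<open>The block containing position \<open>(i, j)\<close> is the same for all
      \<open>x\<close>, so the case distinction can be made outside the function.\<close>
    have "(\<lambda>x. four_block_mat (A k x) (0\<^sub>m (r k) c') (0\<^sub>m r' (c k)) (B x) $$ (i, j)) =
      (if i < r k \<and> j < c k then (\<lambda>x. A k x $$ (i, j))
       else if i < r k \<or> j < c k then (\<lambda>x. 0) else (\<lambda>x. B x $$ (i - r k, j - c k)))"
      using ij by auto
    also have "\<dots> \<in> meadow G"
      using ij by (auto intro!: definable_mat_index[OF A] definable_mat_index[OF B] meadow_const)
    finally show "(\<lambda>x. four_block_mat (A k x) (0\<^sub>m (r k) c') (0\<^sub>m r' (c k)) (B x) $$ (i, j)) \<in> meadow G" .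
  qed
  thus ?case by (simp add: Let_def B_def[symmetric] r'_def[symmetric] c'_def[symmetric])
qed

lemma definable_mat_adjoin_base:
  "definable_mat G r c A \<Longrightarrow> definable_mat (adjoin_coords I G) r c (\<lambda>z. A (fst z))"
  by (auto simp: definable_mat_def intro: meadow_adjoin_base)

text \<open>Naming the inverse \<open>Q\<close> turns invertibility into matrix equations of fixed
  size, as definability needs.\<close>

lemma rep_iso_iff:
  "rep_iso n E s t d f g \<longleftrightarrow> (\<exists>P Q. (\<forall>i<n. P i \<in> carrier_mat (d i) (d i) \<and> Q i \<in> carrier_mat (d i) (d i)
      \<and> P i * Q i = 1\<^sub>m (d i) \<and> Q i * P i = 1\<^sub>m (d i)) \<and> (\<forall>a\<in>E. P (t a) * f a = g a * P (s a)))"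
    (is "_ \<longleftrightarrow> ?r")
proof
  assume "rep_iso n E s t d f g"
  then obtain P where P: "\<forall>i<n. P i \<in> carrier_mat (d i) (d i) \<and> invertible_mat (P i)"
    "\<forall>a\<in>E. P (t a) * f a = g a * P (s a)" unfolding rep_iso_def by blast
  have "\<exists>B. B \<in> carrier_mat (d i) (d i) \<and> P i * B = 1\<^sub>m (d i) \<and> B * P i = 1\<^sub>m (d i)" if "i < n" for i
  proof -
    have Pi: "P i \<in> carrier_mat (d i) (d i)" using P that by blast
    have "invertible_mat (P i)" using P that by blast
    then obtain B where "P i * B = 1\<^sub>m (dim_row (P i))" "B * P i = 1\<^sub>m (dim_row B)"
      unfolding invertible_mat_def inverts_mat_def by blast
    hence B: "P i * B = 1\<^sub>m (d i)" "B * P i = 1\<^sub>m (dim_row B)" using Pi by auto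
    \<comment> \<open>\<open>invertible_mat\<close> does not state the shape of \<open>B\<close>.
      Comparing dimensions in the two equations recovers it.\<close>
    have "dim_col (P i * B) = d i" "dim_col (B * P i) = dim_row B" unfolding B by simp_all
    hence "B \<in> carrier_mat (d i) (d i)" using Pi by auto
    thus ?thesis using B by auto
  qed
  then obtain Q where "\<forall>i<n. Q i \<in> carrier_mat (d i) (d i) \<and> P i * Q i = 1\<^sub>m (d i) \<and> Q i * P i = 1\<^sub>m (d i)"
    by metis
  with P show ?r by blast
next
  assume ?r
  then obtain P Q where P: "\<forall>i<n. P i \<in> carrier_mat (d i) (d i) \<and> Q i \<in> carrier_mat (d i) (d i)
      \<and> P i * Q i = 1\<^sub>m (d i) \<and> Q i * P i = 1\<^sub>m (d i)" "\<forall>a\<in>E. P (t a) * f a = g a * P (s a)" by blast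
  have "invertible_mat (P i)" if "i < n" for i
    using P that unfolding invertible_mat_def inverts_mat_def by (intro conjI exI[of _ "Q i"]) auto
  with P show "rep_iso n E s t d f g" unfolding rep_iso_def by blast
qed

lemma is_rep_cong:
  "(\<And>a. a \<in> E \<Longrightarrow> f a = g a) \<Longrightarrow> (\<And>a. a \<in> E \<Longrightarrow> d (s a) = d' (s a) \<and> d (t a) = d' (t a))
    \<Longrightarrow> is_rep E s t d f \<longleftrightarrow> is_rep E s t d' g"
  unfolding is_rep_def by auto

lemma rep_iso_cong:
  "(\<And>a. a \<in> E \<Longrightarrow> f a = f' a) \<Longrightarrow> (\<And>a. a \<in> E \<Longrightarrow> g a = g' a) \<Longrightarrow> (\<And>i. i < n \<Longrightarrow> d i = d' i)
    \<Longrightarrow> rep_iso n E s t d f g \<longleftrightarrow> rep_iso n E s t d' f' g'"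
  unfolding rep_iso_def by (auto cong: ball_cong)

lemma nonzero_dim_cong: "(\<And>i. i < n \<Longrightarrow> d i = d' i) \<Longrightarrow> nonzero_dim n d \<longleftrightarrow> nonzero_dim n d'"
  unfolding nonzero_dim_def by auto

lemma indecomposable_cong:
  assumes "\<And>a. a \<in> E \<Longrightarrow> s a < n \<and> t a < n" "\<And>a. a \<in> E \<Longrightarrow> f a = g a" "\<And>i. i < n \<Longrightarrow> d i = d' i"
  shows "indecomposable n E s t d f \<longleftrightarrow> indecomposable n E s t d' g"
proof -
  have "is_rep E s t d f \<longleftrightarrow> is_rep E s t d' g" by (rule is_rep_cong) (use assms in auto)
  moreover have "rep_iso n E s t d f h \<longleftrightarrow> rep_iso n E s t d' g h" for h
    by (rule rep_iso_cong) (use assms in auto)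
  moreover have "nonzero_dim n d \<longleftrightarrow> nonzero_dim n d'" by (rule nonzero_dim_cong) (use assms in auto)
  ultimately show ?thesis using assms(3) unfolding indecomposable_def by simp
qed

section \<open>Splitting into prescribed dimension vectors\<close>

text \<open>The predicate on summands is a parameter because the notion has two uses: with
  \<open>is_rep\<close> when indecomposability is reformulated, and with
  \<open>indecomposable\<close> for the final decomposition.\<close>

definition splits_into :: "((nat \<Rightarrow> nat) \<Rightarrow> ('e \<Rightarrow> 'a::field mat) \<Rightarrow> bool) \<Rightarrow> nat \<Rightarrow> 'e set \<Rightarrow> ('e \<Rightarrow> nat)
    \<Rightarrow> ('e \<Rightarrow> nat) \<Rightarrow> (nat \<Rightarrow> nat) \<Rightarrow> (nat \<Rightarrow> nat) list \<Rightarrow> ('e \<Rightarrow> 'a mat) \<Rightarrow> bool" where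
  "splits_into Q n E s t d ds f \<longleftrightarrow> (\<exists>fs. length fs = length ds \<and> (\<forall>j<length ds. Q (ds ! j) (fs ! j))
      \<and> rep_iso n E s t d f (rep_sum fs))"

definition bounded_dims :: "nat \<Rightarrow> (nat \<Rightarrow> nat) \<Rightarrow> (nat \<Rightarrow> nat) set" where
  "bounded_dims n d = {\<delta>. (\<forall>i<n. \<delta> i \<le> d i) \<and> (\<forall>i\<ge>n. \<delta> i = 0)}"

lemma finite_bounded_dims: "finite (bounded_dims n d)"
proof (rule finite_subset)
  show "finite {\<delta>. \<forall>i. (i \<in> {..<n} \<longrightarrow> \<delta> i \<in> {..\<Sum>i<n. d i}) \<and> (i \<notin> {..<n} \<longrightarrow> \<delta> i = 0)}"
    by (intro finite_set_of_finite_funs) auto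
  have "d i \<le> (\<Sum>i<n. d i)" if "i < n" for i using that by (intro member_le_sum) auto
  thus "bounded_dims n d \<subseteq> {\<delta>. \<forall>i. (i \<in> {..<n} \<longrightarrow> \<delta> i \<in> {..\<Sum>i<n. d i}) \<and> (i \<notin> {..<n} \<longrightarrow> \<delta> i = 0)}"
    unfolding bounded_dims_def by (auto intro: order_trans)
qed

text \<open>Summand dimensions matter only at vertices and are bounded by \<open>d\<close> there. So
  the quantifiers over \<open>d1\<close> and \<open>d2\<close> become finite disjunctions, and only
  the one over matrices is left for elimination.\<close>

lemma indecomposable_iff_splits_into:
  assumes st: "\<And>a. a \<in> E \<Longrightarrow> s a < n \<and> t a < n"
  shows "indecomposable n E s t d f \<longleftrightarrow> is_rep E s t d f \<and> nonzero_dim n d \<and>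
    \<not> (\<exists>d1\<in>bounded_dims n d. \<exists>d2\<in>bounded_dims n d. ((\<forall>i<n. d i = d1 i + d2 i) \<and> nonzero_dim n d1 \<and> nonzero_dim n d2)
      \<and> splits_into (is_rep E s t) n E s t d [d1, d2] f)"
proof -
  have "(\<exists>d1 d2 f1 f2. (\<forall>i<n. d i = d1 i + d2 i) \<and> nonzero_dim n d1 \<and> nonzero_dim n d2
        \<and> is_rep E s t d1 f1 \<and> is_rep E s t d2 f2 \<and> rep_iso n E s t d f (rep_sum [f1, f2])) \<longleftrightarrow>
    (\<exists>d1\<in>bounded_dims n d. \<exists>d2\<in>bounded_dims n d. ((\<forall>i<n. d i = d1 i + d2 i) \<and> nonzero_dim n d1 \<and> nonzero_dim n d2)
      \<and> splits_into (is_rep E s t) n E s t d [d1, d2] f)" (is "?l \<longleftrightarrow> ?r")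
  proof
    assume ?l
    then obtain d1 d2 f1 f2 where *: "\<forall>i<n. d i = d1 i + d2 i" "nonzero_dim n d1" "nonzero_dim n d2"
        "is_rep E s t d1 f1" "is_rep E s t d2 f2" "rep_iso n E s t d f (rep_sum [f1, f2])" by blast
    \<comment> \<open>Cutting off outside the vertices affects no matrix, since arrows start and end
      at vertices.\<close>
    define e where "e \<delta> i = (if i < n then \<delta> i else 0)" for \<delta> :: "nat \<Rightarrow> nat" and i
    have "e d1 \<in> bounded_dims n d" "e d2 \<in> bounded_dims n d" "\<forall>i<n. d i = e d1 i + e d2 i"
      using * by (auto simp: bounded_dims_def e_def)
    moreover have "nonzero_dim n (e d1)" "nonzero_dim n (e d2)"
      using * by (auto simp: nonzero_dim_def e_def)
    moreover have "is_rep E s t (e d1) f1" "is_rep E s t (e d2) f2"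
      using * st by (auto simp: is_rep_def e_def)
    hence "splits_into (is_rep E s t) n E s t d [e d1, e d2] f"
      using * unfolding splits_into_def by (intro exI[of _ "[f1, f2]"]) (auto simp: less_Suc_eq)
    ultimately show ?r by blast
  next
    assume ?r
    then obtain d1 d2 where *: "\<forall>i<n. d i = d1 i + d2 i" "nonzero_dim n d1" "nonzero_dim n d2"
      "splits_into (is_rep E s t) n E s t d [d1, d2] f" by blast
    then obtain fs where fs: "length fs = 2" "\<forall>j<2. is_rep E s t ([d1, d2] ! j) (fs ! j)"
      "rep_iso n E s t d f (rep_sum fs)" unfolding splits_into_def by (auto simp: numeral_2_eq_2)
    then obtain f1 f2 where "fs = [f1, f2]" by (auto simp: numeral_2_eq_2 length_Suc_conv)
    moreover from this have "is_rep E s t d1 f1" "is_rep E s t d2 f2"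
      using fs(2)[rule_format, of 0] fs(2)[rule_format, of 1] by auto
    ultimately show ?l using fs(3) * by blast
  qed
  thus ?thesis unfolding indecomposable_def by simp
qed

text \<open>The variables to be eliminated are the entries of the base changes and of their
  inverses.\<close>

lemma definable_rep_iso:
  fixes F H :: "'x \<Rightarrow> 'e \<Rightarrow> 'a::field mat"
  assumes ac: "alg_closed TYPE('a)" and E: "finite E" "\<And>a. a \<in> E \<Longrightarrow> s a < n \<and> t a < n"
    and F: "\<And>a. a \<in> E \<Longrightarrow> definable_mat G (d (t a)) (d (s a)) (\<lambda>x. F x a)"
    and H: "\<And>a. a \<in> E \<Longrightarrow> definable_mat G (d (t a)) (d (s a)) (\<lambda>x. H x a)"
  shows "definable G (\<lambda>x. rep_iso n E s t d (F x) (H x))"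
proof -
  \<comment> \<open>The Boolean tells a base change (\<open>True\<close>) from its inverse
    (\<open>False\<close>). Vertex, row and column follow.\<close>
  define I where "I = (UNIV :: bool set) \<times> (SIGMA i:{..<n}. {..<d i} \<times> {..<d i})"
  define M where "M b h i = mat (d i) (d i) (\<lambda>(k, l). h (b, i, k, l))"
    for b and h :: "bool \<times> nat \<times> nat \<times> nat \<Rightarrow> 'a" and i
  have M: "definable_mat (adjoin_coords I G) (d i) (d i) (\<lambda>z. M b (snd z) i)" if "i < n" for b i
    unfolding M_def using that by (intro definable_mat_mat) (auto simp: I_def intro: meadow_adjoin_coord)
  define R where "R z \<longleftrightarrow> (\<forall>i\<in>{..<n}. M True (snd z) i * M False (snd z) i = 1\<^sub>m (d i) \<and>
      M False (snd z) i * M True (snd z) i = 1\<^sub>m (d i)) \<and>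
      (\<forall>a\<in>E. M True (snd z) (t a) * F (fst z) a = H (fst z) a * M True (snd z) (s a))" for z
  have inv: "definable (adjoin_coords I G) (\<lambda>z. M b (snd z) i * M c (snd z) i = 1\<^sub>m (d i))"
    if "i < n" for b c i
    by (rule definable_mat_eq[OF definable_mat_mult[OF M M] definable_mat_const]) (use that in auto)
  have hom: "definable (adjoin_coords I G)
      (\<lambda>z. M True (snd z) (t a) * F (fst z) a = H (fst z) a * M True (snd z) (s a))" if "a \<in> E" for a
    using E that
    by (intro definable_mat_eq[OF definable_mat_mult[OF M definable_mat_adjoin_base[OF F]]
          definable_mat_mult[OF definable_mat_adjoin_base[OF H] M]]) auto
  have "definable (adjoin_coords I G) R"
    unfolding R_def[abs_def] using E by (intro definable_conj definable_ball inv hom) auto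
  hence "definable G (\<lambda>x. \<exists>h. R (x, h))"
    by (intro definable_ex_coords[of I] ac) (auto simp: I_def)
  thus ?thesis
  proof (rule definable_cong)
    fix x
    show "(\<exists>h. R (x, h)) \<longleftrightarrow> rep_iso n E s t d (F x) (H x)"
    proof
      assume "\<exists>h. R (x, h)"
      then obtain h where "R (x, h)" by blast
      thus "rep_iso n E s t d (F x) (H x)"
        unfolding rep_iso_iff R_def by (intro exI[of _ "M True h"] exI[of _ "M False h"]) (auto simp: M_def)
    next
      assume "rep_iso n E s t d (F x) (H x)"
      then obtain P Q where PQ: "\<forall>i<n. P i \<in> carrier_mat (d i) (d i) \<and> Q i \<in> carrier_mat (d i) (d i)
        \<and> P i * Q i = 1\<^sub>m (d i) \<and> Q i * P i = 1\<^sub>m (d i)" "\<forall>a\<in>E. P (t a) * F x a = H x a * P (s a)"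
        unfolding rep_iso_iff by blast
      define h where "h = (\<lambda>(b, i, k, l). (if b then P i else Q i) $$ (k, l))"
      have "M True h i = P i" "M False h i = Q i" if "i < n" for i
        using PQ that by (auto simp: M_def h_def intro!: eq_matI)
      hence "R (x, h)" using PQ E by (auto simp: R_def)
      thus "\<exists>h. R (x, h)" by blast
    qed
  qed
qed

text \<open>The variables are the entries of all summands, and \<open>Q\<close> is evaluated at
  matrices built from them. Hence \<open>Q\<close> must be definable over the enlarged generators,
  and insensitive to values off \<open>E\<close>, where the rebuilt matrices need not agree with the
  given ones. The assumption on \<open>ds\<close> gives the direct sum the size
  \<open>d\<close>.\<close>

lemma definable_splits_into:
  fixes F :: "'x \<Rightarrow> 'e \<Rightarrow> 'a::field mat"
  assumes ac: "alg_closed TYPE('a)" and E: "finite E" "\<And>a. a \<in> E \<Longrightarrow> s a < n \<and> t a < n"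
    and F: "\<And>a. a \<in> E \<Longrightarrow> definable_mat G (d (t a)) (d (s a)) (\<lambda>x. F x a)"
    and ds: "\<And>i. i < n \<Longrightarrow> d i = (\<Sum>\<delta>\<leftarrow>ds. \<delta> i)"
    and Q_rep: "\<And>\<delta> f. Q \<delta> f \<Longrightarrow> is_rep E s t \<delta> f"
    and Q_cong: "\<And>\<delta> f g. (\<And>a. a \<in> E \<Longrightarrow> f a = g a) \<Longrightarrow> Q \<delta> f \<longleftrightarrow> Q \<delta> g"
    and Q_definable: "\<And>\<delta> I (F :: 'x \<times> (nat \<times> 'e \<times> nat \<times> nat \<Rightarrow> 'a) \<Rightarrow> 'e \<Rightarrow> 'a mat).
      (\<And>a. a \<in> E \<Longrightarrow> definable_mat (adjoin_coords I G) (\<delta> (t a)) (\<delta> (s a)) (\<lambda>z. F z a))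
        \<Longrightarrow> definable (adjoin_coords I G) (\<lambda>z. Q \<delta> (F z))"
  shows "definable G (\<lambda>x. splits_into Q n E s t d ds (F x))"
proof -
  define r where "r = length ds"
  define I where "I = (SIGMA j:{..<r}. SIGMA a:E. {..<(ds ! j) (t a)} \<times> {..<(ds ! j) (s a)})"
  define M where "M h j a = mat ((ds ! j) (t a)) ((ds ! j) (s a)) (\<lambda>(k, l). h (j, a, k, l))"
    for h :: "nat \<times> 'e \<times> nat \<times> nat \<Rightarrow> 'a" and j a
  have M: "definable_mat (adjoin_coords I G) ((ds ! j) (t a)) ((ds ! j) (s a)) (\<lambda>z. M (snd z) j a)"
    if "j < r" "a \<in> E" for j a
    unfolding M_def using that by (intro definable_mat_mat) (auto simp: I_def intro: meadow_adjoin_coord)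
  have S: "definable_mat (adjoin_coords I G) (d (t a)) (d (s a)) (\<lambda>z. rep_sum (map (M (snd z)) [0..<r]) a)"
    if a: "a \<in> E" for a
  proof -
    have "d i = (\<Sum>j\<leftarrow>[0..<r]. (ds ! j) i)" if "i < n" for i
      unfolding ds[OF that] r_def by (simp add: sum_list_sum_nth)
    hence "d (t a) = (\<Sum>j\<leftarrow>[0..<r]. (ds ! j) (t a))" "d (s a) = (\<Sum>j\<leftarrow>[0..<r]. (ds ! j) (s a))"
      using E a by auto
    moreover have "definable_mat (adjoin_coords I G) (\<Sum>j\<leftarrow>[0..<r]. (ds ! j) (t a)) (\<Sum>j\<leftarrow>[0..<r]. (ds ! j) (s a))
      (\<lambda>z. diag_block_mat (map (\<lambda>j. M (snd z) j a) [0..<r]))"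
      by (rule definable_mat_diag) (use M a in auto)
    ultimately show ?thesis by (simp add: rep_sum_def o_def)
  qed
  define R where "R z \<longleftrightarrow> (\<forall>j\<in>{..<r}. Q (ds ! j) (M (snd z) j)) \<and>
      rep_iso n E s t d (F (fst z)) (rep_sum (map (M (snd z)) [0..<r]))" for z
  have "definable (adjoin_coords I G) R"
    unfolding R_def[abs_def]
    by (intro definable_conj definable_ball definable_rep_iso Q_definable ac E M S
         definable_mat_adjoin_base F) auto
  hence "definable G (\<lambda>x. \<exists>h. R (x, h))"
    using E by (intro definable_ex_coords[of I] ac) (auto simp: I_def)
  thus ?thesis
  proof (rule definable_cong)
    fix x
    show "(\<exists>h. R (x, h)) \<longleftrightarrow> splits_into Q n E s t d ds (F x)"
    proof
      assume "\<exists>h. R (x, h)"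
      then obtain h where "R (x, h)" by blast
      thus "splits_into Q n E s t d ds (F x)"
        unfolding splits_into_def R_def r_def by (intro exI[of _ "map (M h) [0..<length ds]"]) auto
    next
      assume "splits_into Q n E s t d ds (F x)"
      then obtain fs where fs: "length fs = r" "\<forall>j<r. Q (ds ! j) (fs ! j)"
        "rep_iso n E s t d (F x) (rep_sum fs)" unfolding splits_into_def r_def by blast
      define h where "h = (\<lambda>(j, a, k, l). (fs ! j) a $$ (k, l))"
      have Mh: "M h j a = (fs ! j) a" if "j < r" "a \<in> E" for j a
        using Q_rep fs(2) that unfolding is_rep_def by (force simp: M_def h_def intro!: eq_matI)
      have "Q (ds ! j) (M h j)" if "j < r" for j
        using Q_cong[of "M h j" "fs ! j"] Mh fs(2) that by blast
      moreover have "rep_sum (map (M h) [0..<r]) a = rep_sum fs a" if "a \<in> E" for a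
        unfolding rep_sum_def using Mh that fs(1) by (intro arg_cong[of _ _ diag_block_mat] nth_equalityI) auto
      hence "rep_iso n E s t d (F x) (rep_sum (map (M h) [0..<r]))"
        using fs(3) rep_iso_cong[of E "F x" "F x" "rep_sum (map (M h) [0..<r])" "rep_sum fs" n d d s t] by blast
      ultimately have "R (x, h)" by (auto simp: R_def)
      thus "\<exists>h. R (x, h)" by blast
    qed
  qed
qed

lemma definable_is_rep:
  assumes "\<And>a. a \<in> E \<Longrightarrow> definable_mat G (d (t a)) (d (s a)) (\<lambda>x. F x a)"
  shows "definable G (\<lambda>x. is_rep E s t d (F x))"
proof -
  have "is_rep E s t d (F x)" for x
    using definable_mat_carrier[OF assms] by (simp add: is_rep_def)
  thus ?thesis by (simp add: definable_const)
qed

lemma definable_indecomposable: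
  fixes F :: "'x \<Rightarrow> 'e \<Rightarrow> 'a::field mat"
  assumes ac: "alg_closed TYPE('a)" and E: "finite E" "\<And>a. a \<in> E \<Longrightarrow> s a < n \<and> t a < n"
    and F: "\<And>a. a \<in> E \<Longrightarrow> definable_mat G (d (t a)) (d (s a)) (\<lambda>x. F x a)"
  shows "definable G (\<lambda>x. indecomposable n E s t d (F x))"
proof -
  have "definable G (\<lambda>x. splits_into (is_rep E s t) n E s t d [d1, d2] (F x))"
    if "\<forall>i<n. d i = d1 i + d2 i" for d1 d2
    using that by (intro definable_splits_into ac E F definable_is_rep) (auto simp: is_rep_def)
  hence "definable G (\<lambda>x. \<exists>d1\<in>bounded_dims n d. \<exists>d2\<in>bounded_dims n d.
      ((\<forall>i<n. d i = d1 i + d2 i) \<and> nonzero_dim n d1 \<and> nonzero_dim n d2)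
      \<and> splits_into (is_rep E s t) n E s t d [d1, d2] (F x))"
    \<comment> \<open>\<open>definable_conj_const\<close> hands the equation between
      \<open>d\<close> and \<open>d1\<close>, \<open>d2\<close> to the definability of the
      splitting.\<close>
    by (intro definable_bex finite_bounded_dims definable_conj_const) auto
  hence "definable G (\<lambda>x. is_rep E s t d (F x) \<and> nonzero_dim n d \<and>
    \<not> (\<exists>d1\<in>bounded_dims n d. \<exists>d2\<in>bounded_dims n d.
      ((\<forall>i<n. d i = d1 i + d2 i) \<and> nonzero_dim n d1 \<and> nonzero_dim n d2)
      \<and> splits_into (is_rep E s t) n E s t d [d1, d2] (F x)))"
    by (intro definable_conj definable_neg definable_is_rep definable_const F)
  thus ?thesis
    by (rule definable_cong) (rule indecomposable_iff_splits_into[symmetric], rule E(2))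
qed

text \<open>The predicate on summands already contains eliminated quantifiers: the alternation is
  resolved from the inside out.\<close>

lemma definable_splits_into_indecomposable:
  fixes F :: "'x \<Rightarrow> 'e \<Rightarrow> 'a::field mat"
  assumes ac: "alg_closed TYPE('a)" and E: "finite E" "\<And>a. a \<in> E \<Longrightarrow> s a < n \<and> t a < n"
    and F: "\<And>a. a \<in> E \<Longrightarrow> definable_mat G (d (t a)) (d (s a)) (\<lambda>x. F x a)"
    and ds: "\<And>i. i < n \<Longrightarrow> d i = (\<Sum>\<delta>\<leftarrow>ds. \<delta> i)"
  shows "definable G (\<lambda>x. splits_into (indecomposable n E s t) n E s t d ds (F x))"
proof (rule definable_splits_into[OF ac E F ds])
  show "is_rep E s t \<delta> f" if "indecomposable n E s t \<delta> f" for \<delta> f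
    using that by (simp add: indecomposable_def)
  show "indecomposable n E s t \<delta> f \<longleftrightarrow> indecomposable n E s t \<delta> g"
    if "\<And>a. a \<in> E \<Longrightarrow> f a = g a" for \<delta> f g
    by (rule indecomposable_cong) (use that E in auto)
qed (auto intro: definable_indecomposable[OF ac E])

subsection \<open>Existence of decompositions\<close>

lemma rep_iso_refl: "is_rep E s t d f \<Longrightarrow> (\<And>a. a \<in> E \<Longrightarrow> s a < n \<and> t a < n) \<Longrightarrow> rep_iso n E s t d f f"
  unfolding rep_iso_iff is_rep_def
  by (intro exI[of _ "\<lambda>i. 1\<^sub>m (d i)"]) auto

text \<open>The recursive definition would unfold a pair with an additional empty block. Shapes and
  products of pairs come from this two-block form, and later proofs delete
  \<open>diag_block_mat.simps\<close> to keep pairs folded.\<close>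

lemma diag_block_mat_pair:
  "diag_block_mat [A, B] = four_block_mat A (0\<^sub>m (dim_row A) (dim_col B)) (0\<^sub>m (dim_row B) (dim_col A)) B"
  by (simp only: diag_block_mat.simps(2)[of A "[B]"] diag_block_mat_singleton Let_def)

lemma diag_block_mat_pair_carrier:
  "A \<in> carrier_mat r1 c1 \<Longrightarrow> B \<in> carrier_mat r2 c2 \<Longrightarrow> diag_block_mat [A, B] \<in> carrier_mat (r1 + r2) (c1 + c2)"
  unfolding diag_block_mat_pair by (intro four_block_carrier_mat)

lemma is_rep_rep_sum:
  assumes "is_rep E s t d1 f1" "is_rep E s t d2 f2"
  shows "is_rep E s t (\<lambda>i. d1 i + d2 i) (rep_sum [f1, f2])"
  using assms unfolding is_rep_def rep_sum_def list.map
  by (auto intro!: diag_block_mat_pair_carrier simp del: diag_block_mat.simps)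

lemma diag_block_mat_pair_mult:
  fixes A B C D :: "'a::semiring_1 mat"
  assumes "A \<in> carrier_mat r1 m1" "B \<in> carrier_mat r2 m2" "C \<in> carrier_mat m1 c1" "D \<in> carrier_mat m2 c2"
  shows "diag_block_mat [A, B] * diag_block_mat [C, D] = diag_block_mat [A * C, B * D]"
proof -
  note [simp] = carrier_matD[OF assms(1)] carrier_matD[OF assms(2)] carrier_matD[OF assms(3)] carrier_matD[OF assms(4)]
  have "diag_block_mat [A, B] * diag_block_mat [C, D] =
    four_block_mat A (0\<^sub>m r1 m2) (0\<^sub>m r2 m1) B * four_block_mat C (0\<^sub>m m1 c2) (0\<^sub>m m2 c1) D"
    unfolding diag_block_mat_pair by simp
  also have "\<dots> = four_block_mat (A * C) (0\<^sub>m r1 c2) (0\<^sub>m r2 c1) (B * D)"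
    using assms by (subst mult_four_block_mat[of _ r1 m1 _ m2 _ r2 _ _ c1 _ c2]) auto
  also have "\<dots> = diag_block_mat [A * C, B * D]"
    unfolding diag_block_mat_pair by simp
  finally show ?thesis .
qed

text \<open>Block-diagonal base changes, with block-diagonal inverses, do it.\<close>

lemma rep_iso_rep_sum:
  fixes f1 f2 g1 g2 :: "'e \<Rightarrow> 'a::field mat"
  assumes st: "\<And>a. a \<in> E \<Longrightarrow> s a < n \<and> t a < n"
    and rep: "is_rep E s t d1 f1" "is_rep E s t d2 f2" "is_rep E s t d1 g1" "is_rep E s t d2 g2"
    and iso: "rep_iso n E s t d1 f1 g1" "rep_iso n E s t d2 f2 g2"
  shows "rep_iso n E s t (\<lambda>i. d1 i + d2 i) (rep_sum [f1, f2]) (rep_sum [g1, g2])"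
proof -
  obtain P1 Q1 where 1: "\<forall>i<n. P1 i \<in> carrier_mat (d1 i) (d1 i) \<and> Q1 i \<in> carrier_mat (d1 i) (d1 i)
      \<and> P1 i * Q1 i = 1\<^sub>m (d1 i) \<and> Q1 i * P1 i = 1\<^sub>m (d1 i)" "\<forall>a\<in>E. P1 (t a) * f1 a = g1 a * P1 (s a)"
    using iso(1) unfolding rep_iso_iff by blast
  obtain P2 Q2 where 2: "\<forall>i<n. P2 i \<in> carrier_mat (d2 i) (d2 i) \<and> Q2 i \<in> carrier_mat (d2 i) (d2 i)
      \<and> P2 i * Q2 i = 1\<^sub>m (d2 i) \<and> Q2 i * P2 i = 1\<^sub>m (d2 i)" "\<forall>a\<in>E. P2 (t a) * f2 a = g2 a * P2 (s a)"
    using iso(2) unfolding rep_iso_iff by blast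
  let ?P = "\<lambda>i. diag_block_mat [P1 i, P2 i]" and ?Q = "\<lambda>i. diag_block_mat [Q1 i, Q2 i]"
  have one: "diag_block_mat [1\<^sub>m (d1 i), 1\<^sub>m (d2 i)] = (1\<^sub>m (d1 i + d2 i) :: 'a mat)" for i
    unfolding diag_block_mat_pair by simp
  show ?thesis
    unfolding rep_iso_iff
  proof (rule exI[of _ ?P], rule exI[of _ ?Q], intro conjI allI impI ballI)
    fix i assume i: "i < n"
    have c: "P1 i \<in> carrier_mat (d1 i) (d1 i)" "P2 i \<in> carrier_mat (d2 i) (d2 i)"
        "Q1 i \<in> carrier_mat (d1 i) (d1 i)" "Q2 i \<in> carrier_mat (d2 i) (d2 i)"
      using 1 2 i by auto
    show "?P i \<in> carrier_mat (d1 i + d2 i) (d1 i + d2 i)" "?Q i \<in> carrier_mat (d1 i + d2 i) (d1 i + d2 i)"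
      by (rule diag_block_mat_pair_carrier[OF c(1,2)] diag_block_mat_pair_carrier[OF c(3,4)])+
    show "?P i * ?Q i = 1\<^sub>m (d1 i + d2 i)"
      unfolding diag_block_mat_pair_mult[OF c] using 1 2 i one by (simp del: diag_block_mat.simps)
    show "?Q i * ?P i = 1\<^sub>m (d1 i + d2 i)"
      unfolding diag_block_mat_pair_mult[OF c(3,4,1,2)] using 1 2 i one by (simp del: diag_block_mat.simps)
  next
    fix a assume a: "a \<in> E"
    have c: "f1 a \<in> carrier_mat (d1 (t a)) (d1 (s a))" "f2 a \<in> carrier_mat (d2 (t a)) (d2 (s a))"
        "g1 a \<in> carrier_mat (d1 (t a)) (d1 (s a))" "g2 a \<in> carrier_mat (d2 (t a)) (d2 (s a))"
      using rep a by (auto simp: is_rep_def)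
    have p: "P1 (t a) \<in> carrier_mat (d1 (t a)) (d1 (t a))" "P2 (t a) \<in> carrier_mat (d2 (t a)) (d2 (t a))"
        "P1 (s a) \<in> carrier_mat (d1 (s a)) (d1 (s a))" "P2 (s a) \<in> carrier_mat (d2 (s a)) (d2 (s a))"
      using 1 2 st[OF a] by auto
    have "?P (t a) * diag_block_mat [f1 a, f2 a] = diag_block_mat [g1 a, g2 a] * ?P (s a)"
      unfolding diag_block_mat_pair_mult[OF p(1,2) c(1,2)] diag_block_mat_pair_mult[OF c(3,4) p(3,4)]
      using 1 2 a by (simp del: diag_block_mat.simps)
    thus "?P (t a) * rep_sum [f1, f2] a = rep_sum [g1, g2] a * ?P (s a)" by (simp add: rep_sum_def del: diag_block_mat.simps)
  qed
qed

lemma rep_iso_trans: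
  fixes f g h :: "'e \<Rightarrow> 'a::field mat"
  assumes st: "\<And>a. a \<in> E \<Longrightarrow> s a < n \<and> t a < n"
    and rep: "is_rep E s t d f" "is_rep E s t d g" "is_rep E s t d h"
    and iso: "rep_iso n E s t d f g" "rep_iso n E s t d g h"
  shows "rep_iso n E s t d f h"
proof -
  obtain P Q where 1: "\<forall>i<n. P i \<in> carrier_mat (d i) (d i) \<and> Q i \<in> carrier_mat (d i) (d i)
      \<and> P i * Q i = 1\<^sub>m (d i) \<and> Q i * P i = 1\<^sub>m (d i)" "\<forall>a\<in>E. P (t a) * f a = g a * P (s a)"
    using iso(1) unfolding rep_iso_iff by blast
  obtain R S where 2: "\<forall>i<n. R i \<in> carrier_mat (d i) (d i) \<and> S i \<in> carrier_mat (d i) (d i)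
      \<and> R i * S i = 1\<^sub>m (d i) \<and> S i * R i = 1\<^sub>m (d i)" "\<forall>a\<in>E. R (t a) * g a = h a * R (s a)"
    using iso(2) unfolding rep_iso_iff by blast
  have inv: "(A * B) * (C * D) = 1\<^sub>m k"
    if "A \<in> carrier_mat k k" "B \<in> carrier_mat k k" "C \<in> carrier_mat k k" "D \<in> carrier_mat k k"
      "B * C = 1\<^sub>m k" "A * D = 1\<^sub>m k" for A B C D :: "'a mat" and k
  proof -
    have "(A * B) * (C * D) = A * ((B * C) * D)"
      using that(1-4) by (simp add: assoc_mult_mat[of _ k k _ k _ k])
    thus ?thesis using that by simp
  qed
  show ?thesis
    unfolding rep_iso_iff
  proof (rule exI[of _ "\<lambda>i. R i * P i"], rule exI[of _ "\<lambda>i. Q i * S i"], intro conjI allI impI ballI)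
    fix i assume i: "i < n"
    show "R i * P i \<in> carrier_mat (d i) (d i)" "Q i * S i \<in> carrier_mat (d i) (d i)"
      using 1 2 i by (auto intro: mult_carrier_mat)
    show "R i * P i * (Q i * S i) = 1\<^sub>m (d i)" "Q i * S i * (R i * P i) = 1\<^sub>m (d i)"
      using 1 2 i by (auto intro!: inv)
  next
    fix a assume a: "a \<in> E"
    let ?t = "d (t a)" and ?s = "d (s a)"
    have c: "f a \<in> carrier_mat ?t ?s" "g a \<in> carrier_mat ?t ?s" "h a \<in> carrier_mat ?t ?s"
      using rep a by (auto simp: is_rep_def)
    have p: "P (t a) \<in> carrier_mat ?t ?t" "P (s a) \<in> carrier_mat ?s ?s"
        "R (t a) \<in> carrier_mat ?t ?t" "R (s a) \<in> carrier_mat ?s ?s"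
      using 1 2 st[OF a] by auto
    have "R (t a) * P (t a) * f a = R (t a) * (P (t a) * f a)" using p c by (intro assoc_mult_mat)
    also have "\<dots> = R (t a) * (g a * P (s a))" using 1 a by simp
    also have "\<dots> = R (t a) * g a * P (s a)" using p c by (intro assoc_mult_mat[symmetric])
    also have "\<dots> = h a * R (s a) * P (s a)" using 2 a by simp
    also have "\<dots> = h a * (R (s a) * P (s a))" using p c by (intro assoc_mult_mat)
    finally show "R (t a) * P (t a) * f a = h a * (R (s a) * P (s a))" .
  qed
qed

lemma is_rep_rep_sum_list:
  assumes "length fs = length ds" "\<And>j. j < length ds \<Longrightarrow> is_rep E s t (ds ! j) (fs ! j)"
  shows "is_rep E s t (\<lambda>i. \<Sum>\<delta>\<leftarrow>ds. \<delta> i) (rep_sum fs)"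
  unfolding is_rep_def
proof (intro ballI carrier_matI)
  fix a assume "a \<in> E"
  hence "dim_row ((fs ! j) a) = (ds ! j) (t a)" "dim_col ((fs ! j) a) = (ds ! j) (s a)"
    if "j < length ds" for j
    using assms(2)[OF that] by (auto simp: is_rep_def)
  hence "map (\<lambda>f. dim_row (f a)) fs = map (\<lambda>\<delta>. \<delta> (t a)) ds" "map (\<lambda>f. dim_col (f a)) fs = map (\<lambda>\<delta>. \<delta> (s a)) ds"
    using assms(1) by (auto intro!: nth_equalityI)
  thus "dim_row (rep_sum fs a) = (\<Sum>\<delta>\<leftarrow>ds. \<delta> (t a))" "dim_col (rep_sum fs a) = (\<Sum>\<delta>\<leftarrow>ds. \<delta> (s a))"
    by (simp_all add: rep_sum_def dim_diag_block_mat o_def)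
qed

text \<open>Nested sums flatten on the nose, so the decompositions of two summands can be
  concatenated.\<close>

lemma rep_sum_append: "rep_sum (fs @ gs) = rep_sum [rep_sum fs, rep_sum gs]"
  by (rule ext) (simp only: rep_sum_def list.map map_append diag_block_mat_append diag_block_mat_pair Let_def)

lemma rep_sum_singleton: "rep_sum [f] = f"
  by (rule ext) (simp only: rep_sum_def list.map diag_block_mat_singleton)

text \<open>The dimension vectors are normalised to vanish outside the vertex set, so that only
  finitely many lists \<open>ds\<close> occur.\<close>
lemma ex_splits_into_indecomposable:
  assumes st: "\<And>a. a \<in> E \<Longrightarrow> s a < n \<and> t a < n"
    and "is_rep E s t d f"
  shows "\<exists>ds. set ds \<subseteq> bounded_dims n d \<and> length ds \<le> (\<Sum>i<n. d i) \<and> (\<forall>i<n. d i = (\<Sum>\<delta>\<leftarrow>ds. \<delta> i))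
    \<and> splits_into (indecomposable n E s t) n E s t d ds f"
  using assms(2)
proof (induction "\<Sum>i<n. d i" arbitrary: d f rule: less_induct)
  case less
  \<comment> \<open>Positivity serves both the descent, as each of two nonzero summands is smaller
    than the whole, and the bound on the number of summands.\<close>
  have pos: "(\<Sum>i<n. \<delta> i) > 0" if "nonzero_dim n \<delta>" for \<delta> :: "nat \<Rightarrow> nat"
    using that by (auto simp: nonzero_dim_def intro: sum_pos2)
  consider "\<not> nonzero_dim n d" | "indecomposable n E s t d f"
    | "nonzero_dim n d" "\<not> indecomposable n E s t d f" by blast
  thus ?case
  proof cases
    case 1
    hence d: "\<forall>i<n. d i = 0" by (auto simp: nonzero_dim_def)
    \<comment> \<open>With \<open>d\<close> zero at all vertices every matrix on an arrow is empty,
      and so is the empty sum.\<close>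
    have "rep_iso n E s t d f (rep_sum [])"
      unfolding rep_iso_def
    proof (intro exI[of _ "\<lambda>i. 1\<^sub>m (d i)"] conjI allI impI ballI)
      fix i show "invertible_mat (1\<^sub>m (d i) :: 'b mat)"
        unfolding invertible_mat_def inverts_mat_def by (intro conjI exI[of _ "1\<^sub>m (d i)"]) auto
    next
      fix a assume "a \<in> E"
      hence "d (s a) = 0" "d (t a) = 0" "f a \<in> carrier_mat (d (t a)) (d (s a))"
        using st d less.prems by (auto simp: is_rep_def)
      thus "1\<^sub>m (d (t a)) * f a = rep_sum [] a * 1\<^sub>m (d (s a))" by (auto simp: rep_sum_def)
    qed auto
    thus ?thesis using d by (intro exI[of _ "[]"]) (auto simp: splits_into_def)
  next
    case 2
    \<comment> \<open>\<open>d\<close> may be nonzero off the vertices; its truncation lies in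
      \<open>bounded_dims\<close>.\<close>
    define e where "e i = (if i < n then d i else 0)" for i
    have "indecomposable n E s t e f \<longleftrightarrow> indecomposable n E s t d f"
      by (rule indecomposable_cong) (use st in \<open>auto simp: e_def\<close>)
    hence "splits_into (indecomposable n E s t) n E s t d [e] f"
      using 2 rep_iso_refl[OF less.prems st]
      unfolding splits_into_def by (intro exI[of _ "[f]"]) (simp add: rep_sum_singleton)
    moreover have "length [e] \<le> (\<Sum>i<n. d i)"
      using pos 2 by (simp add: indecomposable_def Suc_le_eq)
    ultimately show ?thesis by (intro exI[of _ "[e]"] conjI) (auto simp: bounded_dims_def e_def)
  next
    case 3
    then obtain d1 d2 f1 f2 where *: "\<forall>i<n. d i = d1 i + d2 i" "nonzero_dim n d1" "nonzero_dim n d2"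
        "is_rep E s t d1 f1" "is_rep E s t d2 f2" "rep_iso n E s t d f (rep_sum [f1, f2])"
      using less.prems unfolding indecomposable_def by blast
    have sum: "(\<Sum>i<n. d i) = (\<Sum>i<n. d1 i) + (\<Sum>i<n. d2 i)" using *(1) by (simp add: sum.distrib)
    obtain ds1 where 1: "set ds1 \<subseteq> bounded_dims n d1" "length ds1 \<le> (\<Sum>i<n. d1 i)"
        "\<forall>i<n. d1 i = (\<Sum>\<delta>\<leftarrow>ds1. \<delta> i)" "splits_into (indecomposable n E s t) n E s t d1 ds1 f1"
      using less.hyps[OF _ *(4)] sum pos[OF *(3)] by auto
    obtain ds2 where 2: "set ds2 \<subseteq> bounded_dims n d2" "length ds2 \<le> (\<Sum>i<n. d2 i)"
        "\<forall>i<n. d2 i = (\<Sum>\<delta>\<leftarrow>ds2. \<delta> i)" "splits_into (indecomposable n E s t) n E s t d2 ds2 f2"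
      using less.hyps[OF _ *(5)] sum pos[OF *(2)] by auto
    obtain fs1 where fs1: "length fs1 = length ds1" "\<forall>j<length ds1. indecomposable n E s t (ds1 ! j) (fs1 ! j)"
      "rep_iso n E s t d1 f1 (rep_sum fs1)" using 1(4) unfolding splits_into_def by blast
    obtain fs2 where fs2: "length fs2 = length ds2" "\<forall>j<length ds2. indecomposable n E s t (ds2 ! j) (fs2 ! j)"
      "rep_iso n E s t d2 f2 (rep_sum fs2)" using 2(4) unfolding splits_into_def by blast
    \<comment> \<open>\<open>d\<close> equals this sum at the vertices but perhaps not as a
      function, so isomorphisms are carried over and back by \<open>rep_iso_cong\<close>.\<close>
    let ?d = "\<lambda>i. d1 i + d2 i"
    have "is_rep E s t (\<lambda>i. \<Sum>\<delta>\<leftarrow>ds1. \<delta> i) (rep_sum fs1)"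
      by (rule is_rep_rep_sum_list) (use fs1 in \<open>auto simp: indecomposable_def\<close>)
    hence r1: "is_rep E s t d1 (rep_sum fs1)" using 1(3) st by (auto simp: is_rep_def)
    have "is_rep E s t (\<lambda>i. \<Sum>\<delta>\<leftarrow>ds2. \<delta> i) (rep_sum fs2)"
      by (rule is_rep_rep_sum_list) (use fs2 in \<open>auto simp: indecomposable_def\<close>)
    hence r2: "is_rep E s t d2 (rep_sum fs2)" using 2(3) st by (auto simp: is_rep_def)
    have "rep_iso n E s t ?d f (rep_sum [f1, f2])"
      using *(1,6) rep_iso_cong[of E f f "rep_sum [f1, f2]" "rep_sum [f1, f2]" n d ?d s t] by blast
    moreover have "is_rep E s t ?d f" using less.prems *(1) st by (auto simp: is_rep_def)
    ultimately have "rep_iso n E s t ?d f (rep_sum [rep_sum fs1, rep_sum fs2])"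
      using rep_iso_trans[OF st _ is_rep_rep_sum[OF *(4,5)] is_rep_rep_sum[OF r1 r2] _
        rep_iso_rep_sum[OF st *(4,5) r1 r2 fs1(3) fs2(3)]] by blast
    hence "rep_iso n E s t d f (rep_sum (fs1 @ fs2))"
      unfolding rep_sum_append
      using *(1) rep_iso_cong[of E f f "rep_sum [rep_sum fs1, rep_sum fs2]" "rep_sum [rep_sum fs1, rep_sum fs2]" n d ?d s t]
      by blast
    hence "splits_into (indecomposable n E s t) n E s t d (ds1 @ ds2) f"
      unfolding splits_into_def using fs1 fs2
      by (intro exI[of _ "fs1 @ fs2"]) (auto simp: nth_append)
    moreover have "bounded_dims n d1 \<subseteq> bounded_dims n d" "bounded_dims n d2 \<subseteq> bounded_dims n d"
      using *(1) by (auto simp: bounded_dims_def trans_le_add1 trans_le_add2)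
    ultimately show ?thesis using 1 2 sum *(1)
      by (intro exI[of _ "ds1 @ ds2"] conjI) auto
  qed
qed

subsection \<open>Generic behaviour on the compatible variety\<close>

text \<open>The nonzero product \<open>p * q\<close> has only finitely many roots.\<close>

lemma infinite_field_poly_mult_nonzero:
  fixes p q :: "'a::field poly"
  assumes "infinite (UNIV :: 'a set)" "p \<noteq> 0" "q \<noteq> 0"
  shows "\<exists>x. poly p x \<noteq> 0 \<and> poly q x \<noteq> 0"
proof -
  have "finite {x. poly (p * q) x = 0}" using assms by (intro poly_roots_finite) simp
  hence "{x. poly (p * q) x = 0} \<noteq> UNIV" using assms(1) by metis
  thus ?thesis by auto
qed

lemma poly_fun_line:
  fixes l :: "'a \<Rightarrow> 'e \<Rightarrow> 'a::field mat"
  assumes "p \<in> poly_fun E s t d"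
    and "\<And>a i j. a \<in> E \<Longrightarrow> i < d (t a) \<Longrightarrow> j < d (s a) \<Longrightarrow> \<exists>u v. \<forall>c. l c a $$ (i, j) = u + c * v"
  shows "\<exists>P. \<forall>c. p (l c) = poly P c"
  using assms(1)
proof induction
  case (pf_const c)
  show ?case by (intro exI[of _ "[:c:]"]) simp
next
  case (pf_coord a i j)
  then obtain u v where "\<forall>c. l c a $$ (i, j) = u + c * v" using assms(2) by blast
  thus ?case by (intro exI[of _ "[:u, v:]"]) simp
next
  case (pf_add p q)
  then obtain P Q where "\<forall>c. p (l c) = poly P c" "\<forall>c. q (l c) = poly Q c" by blast
  thus ?case by (intro exI[of _ "P + Q"]) simp
next
  case (pf_mult p q)
  then obtain P Q where "\<forall>c. p (l c) = poly P c" "\<forall>c. q (l c) = poly Q c" by blast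
  thus ?case by (intro exI[of _ "P * Q"]) simp
qed

text \<open>The relation is linear in the intertwiner, so it passes to the whole line through
  \<open>F\<close> and \<open>G\<close>.\<close>

lemma intertwining_line:
  fixes A B F G :: "'a::field mat"
  assumes c: "A \<in> carrier_mat r r" "B \<in> carrier_mat k k" "F \<in> carrier_mat r k" "G \<in> carrier_mat r k"
    and e: "A * F = F * B" "A * G = G * B"
  shows "A * (F + c \<cdot>\<^sub>m (G - F)) = (F + c \<cdot>\<^sub>m (G - F)) * B"
proof -
  have d: "G - F \<in> carrier_mat r k" by (rule minus_carrier_mat[OF c(3)])
  show ?thesis
    unfolding mult_add_distrib_mat[OF c(1,3) smult_carrier_mat[OF d]] mult_smult_distrib[OF c(1) d]
      mult_minus_distrib_mat[OF c(1,4,3)] add_mult_distrib_mat[OF c(3) smult_carrier_mat[OF d] c(2)]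
      mult_smult_assoc_mat[OF d c(2)] minus_mult_distrib_mat[OF c(4,3,2)] e ..
qed

lemma compat_var_line:
  assumes f: "f \<in> compat_var E s t d N" and g: "g \<in> compat_var E s t d N"
    and st: "\<And>a. a \<in> E \<Longrightarrow> s a < n \<and> t a < n" and N: "\<And>i. i < n \<Longrightarrow> N i \<in> carrier_mat (d i) (d i)"
  shows "(\<lambda>a. if a \<in> E then f a + c \<cdot>\<^sub>m (g a - f a) else 0\<^sub>m 0 0) \<in> compat_var E s t d N"
proof -
  have "N (t a) * (f a + c \<cdot>\<^sub>m (g a - f a)) = (f a + c \<cdot>\<^sub>m (g a - f a)) * N (s a)" if a: "a \<in> E" for a
    by (rule intertwining_line[of _ "d (t a)" _ "d (s a)"]) (use f g st[OF a] N a in \<open>auto simp: compat_var_def\<close>)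
  moreover have "f a + c \<cdot>\<^sub>m (g a - f a) \<in> carrier_mat (d (t a)) (d (s a))" if "a \<in> E" for a
    using f g that by (intro add_carrier_mat smult_carrier_mat minus_carrier_mat) (auto simp: compat_var_def)
  ultimately show ?thesis by (auto simp: compat_var_def)
qed

text \<open>The variety is a linear space, hence irreducible: restrict \<open>p\<close> and \<open>q\<close> to a line.\<close>
lemma compat_var_irreducible:
  fixes N :: "nat \<Rightarrow> 'a::field mat"
  assumes inf: "infinite (UNIV :: 'a set)"
    and st: "\<And>a. a \<in> E \<Longrightarrow> s a < n \<and> t a < n" and N: "\<And>i. i < n \<Longrightarrow> N i \<in> carrier_mat (d i) (d i)"
    and p: "p \<in> poly_fun E s t d" "\<exists>x\<in>compat_var E s t d N. p x \<noteq> 0"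
    and q: "q \<in> poly_fun E s t d" "\<exists>x\<in>compat_var E s t d N. q x \<noteq> 0"
  shows "\<exists>x\<in>compat_var E s t d N. p x \<noteq> 0 \<and> q x \<noteq> 0"
proof -
  obtain f g where f: "f \<in> compat_var E s t d N" "p f \<noteq> 0" and g: "g \<in> compat_var E s t d N" "q g \<noteq> 0"
    using p q by blast
  \<comment> \<open>The line meets \<open>f\<close> at parameter 0 and \<open>g\<close> at 1. Off
    \<open>E\<close> it takes the canonical value of \<open>compat_var\<close>, so that both
    equalities hold as functions.\<close>
  define l where "l c = (\<lambda>a. if a \<in> E then f a + c \<cdot>\<^sub>m (g a - f a) else 0\<^sub>m 0 0)" for c
  have l: "l c \<in> compat_var E s t d N" for c
    unfolding l_def by (rule compat_var_line) (use f g st N in auto)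
  have carrier: "f a \<in> carrier_mat (d (t a)) (d (s a))" "g a \<in> carrier_mat (d (t a)) (d (s a))" if "a \<in> E" for a
    using f g that by (auto simp: compat_var_def)
  have l0: "l 0 = f"
  proof
    fix a show "l 0 a = f a"
    proof (cases "a \<in> E")
      case True
      note [simp] = carrier_matD[OF carrier(1)[OF True]] carrier_matD[OF carrier(2)[OF True]]
      show ?thesis by (intro eq_matI) (simp_all add: l_def True)
    qed (use f g in \<open>simp add: l_def compat_var_def\<close>)
  qed
  have l1: "l 1 = g"
  proof
    fix a show "l 1 a = g a"
    proof (cases "a \<in> E")
      case True
      note [simp] = carrier_matD[OF carrier(1)[OF True]] carrier_matD[OF carrier(2)[OF True]]
      show ?thesis by (intro eq_matI) (simp_all add: l_def True)
    qed (use f g in \<open>simp add: l_def compat_var_def\<close>)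
  qed
  have line: "\<exists>u v. \<forall>c. l c a $$ (i, j) = u + c * v" if "a \<in> E" "i < d (t a)" "j < d (s a)" for a i j
    using carrier[OF that(1)] that
    by (intro exI[of _ "f a $$ (i, j)"] exI[of _ "g a $$ (i, j) - f a $$ (i, j)"]) (auto simp: l_def)
  have "\<exists>P. \<forall>c. p (l c) = poly P c" by (rule poly_fun_line[OF p(1)]) (rule line)
  then obtain P where P: "\<forall>c. p (l c) = poly P c" ..
  have "\<exists>Q. \<forall>c. q (l c) = poly Q c" by (rule poly_fun_line[OF q(1)]) (rule line)
  then obtain Q where Q: "\<forall>c. q (l c) = poly Q c" ..
  have "P \<noteq> 0" using P l0 f by (metis poly_0)
  moreover have "Q \<noteq> 0" using Q l1 g by (metis poly_0)
  ultimately obtain c where "poly P c \<noteq> 0" "poly Q c \<noteq> 0"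
    using infinite_field_poly_mult_nonzero[OF inf] by blast
  thus ?thesis using l P Q by (intro bexI[of _ "l c"]) auto
qed

section \<open>Definable properties on an irreducible set\<close>

definition coord_funs :: "'e set \<Rightarrow> ('e \<Rightarrow> nat) \<Rightarrow> ('e \<Rightarrow> nat) \<Rightarrow> (nat \<Rightarrow> nat)
    \<Rightarrow> (('e \<Rightarrow> 'a::field mat) \<Rightarrow> 'a) set" where
  "coord_funs E s t d = {\<lambda>f. f a $$ (i, j) | a i j. a \<in> E \<and> i < d (t a) \<and> j < d (s a)}"

text \<open>Rational functions on an irreducible set form a field. Sums and products live where both
  denominators are nonzero, which happens somewhere by \<open>irred\<close>. An inverse exists
  unless the numerator vanishes on all of \<open>X\<close>, and then it is 0 by convention.\<close>

lemma meadow_generic_fraction: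
  fixes X :: "('e \<Rightarrow> 'a::field mat) set"
  assumes irred: "\<And>p q. p \<in> poly_fun E s t d \<Longrightarrow> q \<in> poly_fun E s t d \<Longrightarrow> \<exists>x\<in>X. p x \<noteq> 0 \<Longrightarrow> \<exists>x\<in>X. q x \<noteq> 0
      \<Longrightarrow> \<exists>x\<in>X. p x \<noteq> 0 \<and> q x \<noteq> 0"
    and ne: "X \<noteq> {}" and p: "p \<in> meadow (coord_funs E s t d)"
  shows "\<exists>a\<in>poly_fun E s t d. \<exists>b\<in>poly_fun E s t d. (\<exists>x\<in>X. b x \<noteq> 0) \<and> (\<forall>x\<in>X. b x \<noteq> 0 \<longrightarrow> p x = a x / b x)"
    (is "?frac p")
proof -
  have fracI: "?frac p" if "a \<in> poly_fun E s t d" "b \<in> poly_fun E s t d" "\<exists>x\<in>X. b x \<noteq> 0"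
      "\<And>x. x \<in> X \<Longrightarrow> b x \<noteq> 0 \<Longrightarrow> p x = a x / b x" for p a b
    using that by blast
  have base: "?frac p" if "p \<in> poly_fun E s t d" for p
    by (rule fracI[OF that pf_const[of 1]]) (use ne in auto)
  have frac2: "\<exists>a\<in>poly_fun E s t d. \<exists>b\<in>poly_fun E s t d. \<exists>c\<in>poly_fun E s t d. \<exists>e\<in>poly_fun E s t d. 
     (\<exists>x\<in>X. b x * e x \<noteq> 0) \<and> (\<forall>x\<in>X. b x * e x \<noteq> 0 \<longrightarrow> p x = a x / b x \<and> q x = c x / e x)"
    if pq: "?frac p" "?frac q" for p q
  proof -
    obtain a b where 1: "a \<in> poly_fun E s t d" "b \<in> poly_fun E s t d" "\<exists>x\<in>X. b x \<noteq> 0"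
      "\<forall>x\<in>X. b x \<noteq> 0 \<longrightarrow> p x = a x / b x" using pq(1) by blast
    obtain c e where 2: "c \<in> poly_fun E s t d" "e \<in> poly_fun E s t d" "\<exists>x\<in>X. e x \<noteq> 0"
      "\<forall>x\<in>X. e x \<noteq> 0 \<longrightarrow> q x = c x / e x" using pq(2) by blast
    have "\<exists>x\<in>X. b x * e x \<noteq> 0" using irred[OF 1(2) 2(2) 1(3) 2(3)] by auto
    moreover have "\<forall>x\<in>X. b x * e x \<noteq> 0 \<longrightarrow> p x = a x / b x \<and> q x = c x / e x"
      using 1(4) 2(4) by auto
    ultimately show ?thesis using 1(1,2) 2(1,2) by blast
  qed
  from p show ?thesis
  proof induction
    case (meadow_gen g)
    thus ?case by (intro base) (auto simp: coord_funs_def intro: pf_coord)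
  next
    case (meadow_const c)
    show ?case by (intro base pf_const)
  next
    case (meadow_add p q)
    from frac2[OF meadow_add.IH] obtain a b c e where *: "a \<in> poly_fun E s t d" "b \<in> poly_fun E s t d"
      "c \<in> poly_fun E s t d" "e \<in> poly_fun E s t d" "\<exists>x\<in>X. b x * e x \<noteq> 0"
      "\<forall>x\<in>X. b x * e x \<noteq> 0 \<longrightarrow> p x = a x / b x \<and> q x = c x / e x" by blast
    show ?case
      by (rule fracI[OF pf_add[OF pf_mult[OF *(1,4)] pf_mult[OF *(3,2)]] pf_mult[OF *(2,4)]])
        (use *(5,6) in \<open>auto simp: add_frac_eq\<close>)
  next
    case (meadow_mult p q)
    from frac2[OF meadow_mult.IH] obtain a b c e where *: "a \<in> poly_fun E s t d" "b \<in> poly_fun E s t d"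
      "c \<in> poly_fun E s t d" "e \<in> poly_fun E s t d" "\<exists>x\<in>X. b x * e x \<noteq> 0"
      "\<forall>x\<in>X. b x * e x \<noteq> 0 \<longrightarrow> p x = a x / b x \<and> q x = c x / e x" by blast
    show ?case
      by (rule fracI[OF pf_mult[OF *(1,3)] pf_mult[OF *(2,4)]]) (use *(5,6) in auto)
  next
    case (meadow_inverse p)
    then obtain a b where *: "a \<in> poly_fun E s t d" "b \<in> poly_fun E s t d" "\<exists>x\<in>X. b x \<noteq> 0"
      "\<forall>x\<in>X. b x \<noteq> 0 \<longrightarrow> p x = a x / b x" by blast
    show ?case
    proof (cases "\<exists>x\<in>X. a x \<noteq> 0")
      case True
      have "\<exists>x\<in>X. a x * b x \<noteq> 0" using irred[OF *(1,2) True *(3)] by auto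
      \<comment> \<open>The fraction is b * b / (a * b): the extra factor keeps to points with
        \<open>b \<noteq> 0\<close>, where the formula for \<open>p\<close> is valid.\<close>
      thus ?thesis
        by (rule fracI[OF pf_mult[OF *(2,2)] pf_mult[OF *(1,2)]]) (use *(4) in auto)
    next
      case False
      thus ?thesis
        by (intro fracI[OF pf_const[of 0] *(2,3)]) (use *(4) in auto)
    qed
  qed
qed

text \<open>Where \<open>b \<noteq> 0\<close> the property says \<open>a = 0\<close>. Either
  \<open>a\<close> vanishes on \<open>X\<close> and the property holds there, or it fails wherever
  \<open>a * b\<close> is nonzero.\<close>

lemma definable_generic:
  fixes X :: "('e \<Rightarrow> 'a::field mat) set"
  assumes irred: "\<And>p q. p \<in> poly_fun E s t d \<Longrightarrow> q \<in> poly_fun E s t d \<Longrightarrow> \<exists>x\<in>X. p x \<noteq> 0 \<Longrightarrow> \<exists>x\<in>X. q x \<noteq> 0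
      \<Longrightarrow> \<exists>x\<in>X. p x \<noteq> 0 \<and> q x \<noteq> 0"
    and ne: "X \<noteq> {}" and P: "definable (coord_funs E s t d) P"
  shows "\<exists>g\<in>poly_fun E s t d. (\<exists>x\<in>X. g x \<noteq> 0) \<and>
    ((\<forall>x\<in>X. g x \<noteq> 0 \<longrightarrow> P x) \<or> (\<forall>x\<in>X. g x \<noteq> 0 \<longrightarrow> \<not> P x))"
proof -
  obtain p where p: "p \<in> meadow (coord_funs E s t d)" "\<forall>x. P x \<longleftrightarrow> p x = 0"
    using P unfolding definable_def by blast
  obtain a b where ab: "a \<in> poly_fun E s t d" "b \<in> poly_fun E s t d" "\<exists>x\<in>X. b x \<noteq> 0"
    "\<forall>x\<in>X. b x \<noteq> 0 \<longrightarrow> p x = a x / b x" using meadow_generic_fraction[OF irred ne p(1)] by blast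
  show ?thesis
  proof (cases "\<exists>x\<in>X. a x \<noteq> 0")
    case True
    have "\<exists>x\<in>X. a x * b x \<noteq> 0" using irred[OF ab(1,2) True ab(3)] by auto
    thus ?thesis using ab(4) p(2) by (intro bexI[OF _ pf_mult[OF ab(1,2)]]) auto
  next
    case False
    thus ?thesis using ab(3,4) p(2) by (intro bexI[OF _ ab(2)]) auto
  qed
qed

text \<open>If no member of the cover held generically, each would fail generically. By
  irreducibility finitely many such failures occur at a common point, which the cover would
  miss.\<close>

lemma finite_definable_cover_generic:
  fixes X :: "('e \<Rightarrow> 'a::field mat) set"
  assumes irred: "\<And>p q. p \<in> poly_fun E s t d \<Longrightarrow> q \<in> poly_fun E s t d \<Longrightarrow> \<exists>x\<in>X. p x \<noteq> 0 \<Longrightarrow> \<exists>x\<in>X. q x \<noteq> 0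
      \<Longrightarrow> \<exists>x\<in>X. p x \<noteq> 0 \<and> q x \<noteq> 0"
    and ne: "X \<noteq> {}" and A: "finite A" "\<And>i. i \<in> A \<Longrightarrow> definable (coord_funs E s t d) (P i)"
    and cover: "\<And>x. x \<in> X \<Longrightarrow> \<exists>i\<in>A. P i x"
  shows "\<exists>i\<in>A. \<exists>g\<in>poly_fun E s t d. (\<exists>x\<in>X. g x \<noteq> 0) \<and> (\<forall>x\<in>X. g x \<noteq> 0 \<longrightarrow> P i x)"
proof (rule ccontr)
  assume contra: "\<not> ?thesis"
  have "\<exists>g\<in>poly_fun E s t d. (\<exists>x\<in>X. g x \<noteq> 0) \<and> (\<forall>x\<in>X. g x \<noteq> 0 \<longrightarrow> (\<forall>i\<in>B. \<not> P i x))"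
    if "finite B" "B \<subseteq> A" for B
    using that
  proof (induction B rule: finite_induct)
    case empty
    show ?case using ne by (intro bexI[of _ "\<lambda>x. 1"] pf_const) auto
  next
    case (insert i B)
    then obtain g where g: "g \<in> poly_fun E s t d" "\<exists>x\<in>X. g x \<noteq> 0"
      "\<forall>x\<in>X. g x \<noteq> 0 \<longrightarrow> (\<forall>i\<in>B. \<not> P i x)" by auto
    obtain h where h: "h \<in> poly_fun E s t d" "\<exists>x\<in>X. h x \<noteq> 0" "\<forall>x\<in>X. h x \<noteq> 0 \<longrightarrow> \<not> P i x"
      using definable_generic[OF irred ne A(2)[of i]] contra insert.prems by blast
    have "\<exists>x\<in>X. g x * h x \<noteq> 0" using irred[OF g(1) h(1) g(2) h(2)] by auto
    thus ?case using g(3) h(3) by (intro bexI[OF _ pf_mult[OF g(1) h(1)]]) auto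
  qed
  from this[OF A(1) order_refl] show False using cover by blast
qed

lemma zariski_open_in_principal:
  "g \<in> poly_fun E s t d \<Longrightarrow> zariski_open_in E s t d X {x \<in> X. g x \<noteq> 0}"
  unfolding zariski_open_in_def zariski_closed_in_def by (auto intro!: exI[of _ "{g}"])

text \<open>A nonempty open set contains a nonempty set \<open>p \<noteq> 0\<close>, with
  \<open>p\<close> among the equations of its complement, and irreducibility makes this meet
  \<open>g \<noteq> 0\<close>.\<close>

lemma zariski_dense_in_principal:
  assumes irred: "\<And>p q. p \<in> poly_fun E s t d \<Longrightarrow> q \<in> poly_fun E s t d \<Longrightarrow> \<exists>x\<in>X. p x \<noteq> 0 \<Longrightarrow> \<exists>x\<in>X. q x \<noteq> 0
      \<Longrightarrow> \<exists>x\<in>X. p x \<noteq> 0 \<and> q x \<noteq> 0"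
    and g: "g \<in> poly_fun E s t d" "\<exists>x\<in>X. g x \<noteq> 0"
  shows "zariski_dense_in E s t d X {x \<in> X. g x \<noteq> 0}"
  unfolding zariski_dense_in_def
proof (intro allI impI)
  fix V assume V: "zariski_open_in E s t d X V \<and> V \<noteq> {}"
  then obtain S where S: "V \<subseteq> X" "S \<subseteq> poly_fun E s t d" "X - V = {x \<in> X. \<forall>p\<in>S. p x = 0}"
    unfolding zariski_open_in_def zariski_closed_in_def by blast
  obtain x where "x \<in> V" using V by blast
  with S obtain p where p: "p \<in> S" "x \<in> X" "p x \<noteq> 0" by blast
  then obtain y where "y \<in> X" "p y \<noteq> 0" "g y \<noteq> 0" using irred[of p g] g S(2) by blast
  with p S(3) show "V \<inter> {x \<in> X. g x \<noteq> 0} \<noteq> {}" by blast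
qed

theorem theorem2p4:
  fixes n :: nat and E :: "'e set" and s t :: "'e \<Rightarrow> nat" and d :: "nat \<Rightarrow> nat"
    and lam :: "nat \<Rightarrow> nat list" and N :: "nat \<Rightarrow> 'a::field mat"
  assumes "alg_closed TYPE('a)"
    and "finite E"
    and "\<forall>a\<in>E. s a < n \<and> t a < n \<and> s a \<noteq> t a"
    and "\<forall>i<n. sorted_wrt (\<ge>) (lam i) \<and> (\<forall>k\<in>set (lam i). k > 0) \<and> sum_list (lam i) = d i"
    and "\<forall>i<n. N i \<in> carrier_mat (d i) (d i) \<and> jordan_nf (N i) (map (\<lambda>k. (k, 0)) (lam i))"
  shows "\<exists>U ds. zariski_open_in E s t d (compat_var E s t d N) U
      \<and> zariski_dense_in E s t d (compat_var E s t d N) U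
      \<and> (\<forall>i<n. d i = (\<Sum>dj\<leftarrow>ds. dj i))
      \<and> (\<forall>M\<in>U. \<exists>fs. length fs = length ds
            \<and> (\<forall>j<length ds. indecomposable n E s t (ds ! j) (fs ! j))
            \<and> rep_iso n E s t d M (rep_sum fs))"
proof -
  define X where "X = compat_var E s t d N"
  have st: "s a < n \<and> t a < n" if "a \<in> E" for a using assms(3) that by blast
  have N: "N i \<in> carrier_mat (d i) (d i)" if "i < n" for i using assms(5) that by blast
  have irred: "\<exists>x\<in>X. p x \<noteq> 0 \<and> q x \<noteq> 0"
    if "p \<in> poly_fun E s t d" "q \<in> poly_fun E s t d" "\<exists>x\<in>X. p x \<noteq> 0" "\<exists>x\<in>X. q x \<noteq> 0" for p q
    unfolding X_def
    by (rule compat_var_irreducible[where n = n, OF alg_closed_infinite[OF assms(1)]])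
      (fact st N that[unfolded X_def])+
  \<comment> \<open>The zero representation is compatible, so the variety has a point, as the
    generic arguments require.\<close>
  have "N (t a) * 0\<^sub>m (d (t a)) (d (s a)) = 0\<^sub>m (d (t a)) (d (s a)) * N (s a)" if "a \<in> E" for a
    using st[OF that] N by (metis left_mult_zero_mat right_mult_zero_mat)
  hence "(\<lambda>a. if a \<in> E then 0\<^sub>m (d (t a)) (d (s a)) else 0\<^sub>m 0 0) \<in> X"
    by (simp add: X_def compat_var_def)
  hence ne: "X \<noteq> {}" by blast
  \<comment> \<open>Lengths are bounded by the total dimension because indecomposable summands are
    nonzero. The condition on sums is what definability of the splitting asks for.\<close>
  define A where "A = {ds. set ds \<subseteq> bounded_dims n d \<and> length ds \<le> (\<Sum>i<n. d i)} \<inter>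
    {ds. \<forall>i<n. d i = (\<Sum>\<delta>\<leftarrow>ds. \<delta> i)}"
  have A: "finite A" unfolding A_def by (intro finite_Int disjI1 finite_lists_length_le finite_bounded_dims)
  \<comment> \<open>Definability is about all functions \<open>f\<close>, so the matrices are first cut to the right shape;
    this changes nothing on \<open>X\<close>.\<close>
  define nrm where "nrm f a = mat (d (t a)) (d (s a)) (\<lambda>ij. f a $$ ij)" for f :: "'e \<Rightarrow> 'a mat" and a
  define P where "P ds f \<longleftrightarrow> splits_into (indecomposable n E s t) n E s t d ds (nrm f)" for ds f
  have P: "P ds f \<longleftrightarrow> splits_into (indecomposable n E s t) n E s t d ds f" if "f \<in> X" for ds f
  proof -
    have "nrm f a = f a" if "a \<in> E" for a
      using \<open>f \<in> X\<close> that by (auto simp: X_def compat_var_def nrm_def intro!: eq_matI)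
    hence "rep_iso n E s t d (nrm f) g \<longleftrightarrow> rep_iso n E s t d f g" for g by (intro rep_iso_cong) auto
    thus ?thesis unfolding P_def splits_into_def by simp
  qed
  have "definable (coord_funs E s t d) (P ds)" if "ds \<in> A" for ds
    unfolding P_def[abs_def]
  proof (rule definable_splits_into_indecomposable[OF assms(1,2) st])
    show "definable_mat (coord_funs E s t d) (d (t a)) (d (s a)) (\<lambda>f. nrm f a)" if "a \<in> E" for a
      unfolding nrm_def using that by (intro definable_mat_mat meadow_gen) (auto simp: coord_funs_def)
    show "d i = (\<Sum>\<delta>\<leftarrow>ds. \<delta> i)" if "i < n" for i using \<open>ds \<in> A\<close> that by (simp add: A_def)
  qed
  moreover have "\<exists>ds\<in>A. P ds f" if "f \<in> X" for f
  proof -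
    have "is_rep E s t d f" using that by (simp add: X_def compat_var_def is_rep_def)
    from ex_splits_into_indecomposable[OF st this] P[OF that] show ?thesis by (auto simp: A_def)
  qed
  ultimately have "\<exists>ds\<in>A. \<exists>g\<in>poly_fun E s t d. (\<exists>x\<in>X. g x \<noteq> 0) \<and> (\<forall>x\<in>X. g x \<noteq> 0 \<longrightarrow> P ds x)"
    using irred ne A by (intro finite_definable_cover_generic)
  then obtain ds g where ds: "ds \<in> A" and g: "g \<in> poly_fun E s t d" "\<exists>x\<in>X. g x \<noteq> 0"
    "\<forall>x\<in>X. g x \<noteq> 0 \<longrightarrow> P ds x" by blast
  show ?thesis
  proof (intro exI[of _ "{x \<in> X. g x \<noteq> 0}"] exI[of _ ds] conjI)
    show "zariski_open_in E s t d (compat_var E s t d N) {x \<in> X. g x \<noteq> 0}"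
      using zariski_open_in_principal[OF g(1)] unfolding X_def .
    show "zariski_dense_in E s t d (compat_var E s t d N) {x \<in> X. g x \<noteq> 0}"
      using zariski_dense_in_principal[OF irred g(1,2)] unfolding X_def .
    show "\<forall>i<n. d i = (\<Sum>dj\<leftarrow>ds. dj i)" using ds by (simp add: A_def)
    show "\<forall>M\<in>{x \<in> X. g x \<noteq> 0}. \<exists>fs. length fs = length ds
        \<and> (\<forall>j<length ds. indecomposable n E s t (ds ! j) (fs ! j)) \<and> rep_iso n E s t d M (rep_sum fs)"
      using g(3) P unfolding splits_into_def by blast
  qed
qed

end
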